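(* Let $\sigma$ (an $N\times m$ matrix-valued function on $\mathbb R^N$) and $b:\mathbb R^N\to\mathbb R^N$ be smooth functions, let $\sigma^j$, $j=1,\dots,m$, be the columns of $\sigma$, and suppose that the vector fields $X_j=\sigma^j\cdot\nabla$, $j=1,\dots,m$, satisfy the Hörmander condition. Consider the equation $$\mathcal LV:=-\mathrm{tr}(\sigma(x)\sigma^T(x)D^2V)-b(x)\cdot DV=0,\qquad x\in\mathbb R^N. \tag{E}$$ Assume that there exist $w\in C^\infty(\mathbb R^N)$ and $R_0>0$ such that $$\mathcal Lw\ge0\ \text{ in }\ \mathbb R^N\setminus\overline{B(0,R_0)},\qquad w(x)\to+\infty\ \text{ as }\ |x|\to+\infty .$$ Then: (i) every viscosity subsolution $V\in USC(\mathbb R^N)$ to (E) such that $\limsup_{|x|\to+\infty}\frac{V(x)}{w(x)}\le0$ is constant; (ii) every viscosity supersolution $V\in LSC(\mathbb R^N)$ to (E) such that $\liminf_{|x|\to+\infty}\frac{V(x)}{w(x)}\ge0$ is constant.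
   Context: The vector fields $X_1,\dots,X_m$ satisfy the Hörmander condition if $X_1,\dots,X_m$ and their commutators of any order span $\mathbb R^N$ at each point of $\mathbb R^N$. $USC$ and $LSC$ denote the (real-valued) upper and lower semicontinuous functions; $B(0,R_0)$ is the open Euclidean ball. *)

theory Defs
  imports "HOL-Analysis.Analysis"
begin

(* C^k on the whole space. Total differentiability, which already follows from continuity of the
   partial derivatives, is demanded so that frechet_derivative denotes an actual derivative. *)
primrec C_k :: "nat \<Rightarrow> ('a::euclidean_space \<Rightarrow> 'b::real_normed_vector) \<Rightarrow> bool" where
  "C_k 0 f \<longleftrightarrow> continuous_on UNIV f"
| "C_k (Suc k) f \<longleftrightarrow> (\<forall>x. f differentiable (at x)) \<and>
     (\<forall>e\<in>Basis. C_k k (\<lambda>x. frechet_derivative f (at x) e))"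

definition smooth :: "('a::euclidean_space \<Rightarrow> 'b::real_normed_vector) \<Rightarrow> bool" where
  "smooth f \<longleftrightarrow> (\<forall>k. C_k k f)"

definition grad :: "(real^'n \<Rightarrow> real) \<Rightarrow> real^'n \<Rightarrow> real^'n" where
  "grad f x = (\<chi> i. frechet_derivative f (at x) (axis i 1))"

definition hess :: "(real^'n \<Rightarrow> real) \<Rightarrow> real^'n \<Rightarrow> real^'n^'n" where
  "hess f x = jacobian (grad f) (at x)"

(* A vector field, i.e. a first-order operator X . grad, is represented by its coefficient map X;
   the coefficients of the commutator of X . grad and Y . grad are DY X - DX Y. *)
definition lie_bracket ::
    "(real^'n \<Rightarrow> real^'n) \<Rightarrow> (real^'n \<Rightarrow> real^'n) \<Rightarrow> real^'n \<Rightarrow> real^'n" where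
  "lie_bracket X Y x = jacobian Y (at x) *v X x - jacobian X (at x) *v Y x"

inductive_set iterated_commutators :: "('m \<Rightarrow> real^'n \<Rightarrow> real^'n) \<Rightarrow> (real^'n \<Rightarrow> real^'n) set"
  for X :: "'m \<Rightarrow> real^'n \<Rightarrow> real^'n" where
  field: "X j \<in> iterated_commutators X"
| bracket: "Y \<in> iterated_commutators X \<Longrightarrow> Z \<in> iterated_commutators X \<Longrightarrow>
    lie_bracket Y Z \<in> iterated_commutators X"

definition hoermander_condition :: "('m \<Rightarrow> real^'n \<Rightarrow> real^'n) \<Rightarrow> bool" where
  "hoermander_condition X \<longleftrightarrow> (\<forall>x. span {Y x | Y. Y \<in> iterated_commutators X} = UNIV)"

definition usc :: "('a::topological_space \<Rightarrow> real) \<Rightarrow> bool" where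
  "usc V \<longleftrightarrow> (\<forall>x. \<forall>a > V x. \<forall>\<^sub>F y in nhds x. V y < a)"

definition lsc :: "('a::topological_space \<Rightarrow> real) \<Rightarrow> bool" where
  "lsc V \<longleftrightarrow> (\<forall>x. \<forall>a < V x. \<forall>\<^sub>F y in nhds x. a < V y)"

definition L_op ::
    "(real^'n \<Rightarrow> real^'m^'n) \<Rightarrow> (real^'n \<Rightarrow> real^'n) \<Rightarrow> (real^'n \<Rightarrow> real) \<Rightarrow> real^'n \<Rightarrow> real" where
  "L_op \<sigma> b f x = - trace (\<sigma> x ** transpose (\<sigma> x) ** hess f x) - b x \<bullet> grad f x"

(* Semicontinuity is not part of these two definitions; it is a separate hypothesis. *)
definition viscosity_subsolution ::
    "(real^'n \<Rightarrow> real^'m^'n) \<Rightarrow> (real^'n \<Rightarrow> real^'n) \<Rightarrow> (real^'n \<Rightarrow> real) \<Rightarrow> bool" where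
  "viscosity_subsolution \<sigma> b V \<longleftrightarrow>
     (\<forall>\<phi> x. C_k 2 \<phi> \<longrightarrow> (\<forall>\<^sub>F y in nhds x. V y - \<phi> y \<le> V x - \<phi> x) \<longrightarrow> L_op \<sigma> b \<phi> x \<le> 0)"

definition viscosity_supersolution ::
    "(real^'n \<Rightarrow> real^'m^'n) \<Rightarrow> (real^'n \<Rightarrow> real^'n) \<Rightarrow> (real^'n \<Rightarrow> real) \<Rightarrow> bool" where
  "viscosity_supersolution \<sigma> b V \<longleftrightarrow>
     (\<forall>\<phi> x. C_k 2 \<phi> \<longrightarrow> (\<forall>\<^sub>F y in nhds x. V x - \<phi> x \<le> V y - \<phi> y) \<longrightarrow> 0 \<le> L_op \<sigma> b \<phi> x)"

end

(*
By linearity and L w >= 0, the function V - zeta w is a subsolution outside the ball of radius R0,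
and it tends to -infinity. Its maximum over |x| >= R0 is attained; the strong maximum principle makes
the maximum set relatively open in |x| > R0, so the point of that set closest to the origin lies on
the sphere |x| = R0. Letting zeta tend to 0, V is bounded by its maximum over the sphere and hence
attains a global maximum, and the strong maximum principle on the whole space makes V constant.

The strong maximum principle is Bony's: by a Hopf barrier, the fields X_j are orthogonal to all exterior
normals of the maximum set F. The fields with this property form a Lie algebra, so under Hoermander's
condition F has no nonzero exterior normal, and is therefore open. Flows are avoided: since X is
orthogonal to the normal at the nearest point of F, one Euler step changes the squared distance to F
by a factor 1 + O(s) plus O(s^2), so Euler polygons with many steps end arbitrarily close to F, and
the points of F obtained in this way approximate the flow of X to second order.
*)

theory Submission
  imports Defs
begin

section \<open>Functions of class C^k\<close>

lemma C_k_continuous: "C_k k f \<Longrightarrow> continuous_on UNIV f"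
proof (cases k)
  case (Suc j)
  assume "C_k k f"
  then have "f differentiable_on UNIV" using Suc by (simp add: differentiable_on_def)
  then show ?thesis by (rule differentiable_imp_continuous_on)
qed simp

lemma C_k_Suc_lessI: "C_k (Suc k) f \<Longrightarrow> C_k k f"
proof (induction k arbitrary: f)
  case 0
  show ?case using C_k_continuous[OF 0] by simp
next
  case (Suc k)
  then show ?case by (subst C_k.simps) (auto simp del: C_k.simps(1) dest: C_k.simps(2)[THEN iffD1])
qed

text \<open>\<open>C_k\<close> is phrased through \<open>frechet_derivative\<close>; uniqueness of
  the derivative lets any explicit formula \<open>f'\<close> take its place.\<close>

lemma C_k_SucI:
  assumes "\<And>x. (f has_derivative f' x) (at x)" "\<And>e. e \<in> Basis \<Longrightarrow> C_k k (\<lambda>x. f' x e)"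
  shows "C_k (Suc k) f"
proof -
  have "frechet_derivative f (at x) = f' x" for x
    using frechet_derivative_at[OF assms(1)] by metis
  then show ?thesis using assms by (auto simp: differentiable_def)
qed

lemma C_k_has_derivative:
  "C_k (Suc k) f \<Longrightarrow> (f has_derivative frechet_derivative f (at x)) (at x)"
  by (auto simp: frechet_derivative_works)

lemma C_k_const: "C_k k (\<lambda>x. c)"
proof (induction k arbitrary: c)
  case (Suc k)
  then show ?case by (auto intro!: C_k_SucI[where f'="\<lambda>x h. 0"])
qed simp

lemma C_k_bounded_linear:
  assumes "bounded_linear T" "C_k k f"
  shows "C_k k (\<lambda>x. T (f x))"
  using assms(2)
proof (induction k arbitrary: f)
  case 0
  then show ?case using linear_continuous_on[OF assms(1)]
    by (auto intro: continuous_on_compose2[of UNIV T])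
next
  case (Suc k)
  show ?case
  proof (rule C_k_SucI)
    show "((\<lambda>x. T (f x)) has_derivative (\<lambda>h. T (frechet_derivative f (at x) h))) (at x)" for x
      by (rule bounded_linear.has_derivative[OF assms(1) C_k_has_derivative[OF Suc.prems]])
    show "C_k k (\<lambda>x. T (frechet_derivative f (at x) e))" if "e \<in> Basis" for e
      using Suc that by auto
  qed
qed

lemma C_k_add:
  "C_k k f \<Longrightarrow> C_k k g \<Longrightarrow> C_k k (\<lambda>x. f x + g x)"
proof (induction k arbitrary: f g)
  case (Suc k)
  show ?case
  proof (rule C_k_SucI)
    show "((\<lambda>x. f x + g x) has_derivative
        (\<lambda>h. frechet_derivative f (at x) h + frechet_derivative g (at x) h)) (at x)" for x
      by (intro has_derivative_add C_k_has_derivative[OF Suc.prems(1)] C_k_has_derivative[OF Suc.prems(2)])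
    show "C_k k (\<lambda>x. frechet_derivative f (at x) e + frechet_derivative g (at x) e)" if "e \<in> Basis" for e
      using Suc that by auto
  qed
qed (auto intro: continuous_intros)

lemma C_k_scaleR:
  "C_k k f \<Longrightarrow> C_k k g \<Longrightarrow> C_k k (\<lambda>x. f x *\<^sub>R g x)"
proof (induction k arbitrary: f g)
  case (Suc k)
  show ?case
  proof (rule C_k_SucI)
    show "((\<lambda>x. f x *\<^sub>R g x) has_derivative
        (\<lambda>h. f x *\<^sub>R frechet_derivative g (at x) h + frechet_derivative f (at x) h *\<^sub>R g x)) (at x)" for x
      by (intro has_derivative_scaleR C_k_has_derivative[OF Suc.prems(1)] C_k_has_derivative[OF Suc.prems(2)])
    show "C_k k (\<lambda>x. f x *\<^sub>R frechet_derivative g (at x) e + frechet_derivative f (at x) e *\<^sub>R g x)"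
      if "e \<in> Basis" for e
      using Suc that C_k_Suc_lessI[OF Suc.prems(1)] C_k_Suc_lessI[OF Suc.prems(2)]
      by (intro C_k_add Suc.IH) (auto simp: C_k.simps(2))
  qed
qed (auto intro: continuous_intros)

lemma C_k_sum:
  "finite I \<Longrightarrow> (\<And>i. i \<in> I \<Longrightarrow> C_k k (f i)) \<Longrightarrow> C_k k (\<lambda>x. \<Sum>i\<in>I. f i x)"
  by (induction I rule: finite_induct) (auto intro: C_k_const C_k_add)

lemma C_k_uminus: "C_k k f \<Longrightarrow> C_k k (\<lambda>x. - f x)"
  by (rule C_k_bounded_linear[OF bounded_linear_minus[OF bounded_linear_ident]])

lemma C_k_id: "C_k k (\<lambda>x. x)"
proof (cases k)
  case (Suc j)
  then show ?thesis by (auto intro!: C_k_SucI[where f'="\<lambda>x h. h"] C_k_const simp del: C_k.simps)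
qed (simp add: continuous_on_id)

lemma smooth_C_k: "smooth f \<Longrightarrow> C_k k f"
  by (simp add: smooth_def)

lemma smooth_bounded_linear: "bounded_linear T \<Longrightarrow> smooth f \<Longrightarrow> smooth (\<lambda>x. T (f x))"
  unfolding smooth_def using C_k_bounded_linear by blast

lemma smooth_has_derivative: "smooth f \<Longrightarrow> (f has_derivative frechet_derivative f (at x)) (at x)"
  by (rule C_k_has_derivative[of 0]) (simp add: smooth_def del: C_k.simps)

lemma linear_eq_sum_Basis:
  fixes T :: "'a::euclidean_space \<Rightarrow> 'b::real_vector"
  assumes "linear T"
  shows "T v = (\<Sum>e\<in>Basis. (v \<bullet> e) *\<^sub>R T e)"
  by (metis (no_types, lifting) assms euclidean_representation linear_sum linear_scale sum.cong)

text \<open>\<open>C_k\<close> controls derivatives in fixed basis directions only. Expanding the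
  moving direction \<open>X x\<close> in the basis turns the expression into a sum of products of
  smooth functions.\<close>

lemma smooth_directional_derivative:
  fixes X :: "'a::euclidean_space \<Rightarrow> 'a" and f :: "'a \<Rightarrow> 'b::real_normed_vector"
  assumes "smooth X" "smooth f"
  shows "smooth (\<lambda>x. frechet_derivative f (at x) (X x))"
proof -
  have "frechet_derivative f (at x) (X x) = (\<Sum>e\<in>Basis. (X x \<bullet> e) *\<^sub>R frechet_derivative f (at x) e)" for x
    using smooth_has_derivative[OF assms(2)] has_derivative_linear linear_eq_sum_Basis by blast
  moreover have "C_k k (\<lambda>x. (\<Sum>e\<in>Basis. (X x \<bullet> e) *\<^sub>R frechet_derivative f (at x) e))" for k
    using smooth_C_k[OF assms(1), of k] smooth_C_k[OF assms(2), of "Suc k"]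
    by (intro C_k_sum C_k_scaleR C_k_bounded_linear[OF bounded_linear_inner_left]) auto
  ultimately show ?thesis by (simp add: smooth_def)
qed

section \<open>Uniform derivative, Lipschitz and Taylor bounds on closed balls\<close>

lemma onorm_le_sum_Basis:
  fixes T :: "'a::euclidean_space \<Rightarrow> 'b::real_normed_vector"
  assumes "linear T"
  shows "onorm T \<le> (\<Sum>e\<in>Basis. norm (T e))"
proof (rule onorm_bound)
  fix v
  have "norm (T v) \<le> (\<Sum>e\<in>Basis. norm ((v \<bullet> e) *\<^sub>R T e))"
    unfolding linear_eq_sum_Basis[OF assms, of v] by (rule norm_sum)
  also have "\<dots> \<le> (\<Sum>e\<in>Basis. norm (T e) * norm v)"
    by (intro sum_mono) (simp add: Basis_le_norm mult.commute[of "norm (T _)"] mult_right_mono)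
  finally show "norm (T v) \<le> (\<Sum>e\<in>Basis. norm (T e)) * norm v"
    by (simp add: sum_distrib_right)
qed (simp add: sum_nonneg)

lemma continuous_bounded_cball:
  fixes f :: "'a::euclidean_space \<Rightarrow> 'b::real_normed_vector"
  assumes "continuous_on UNIV f"
  obtains B where "0 \<le> B" "\<And>x. x \<in> cball p r \<Longrightarrow> norm (f x) \<le> B"
proof -
  have "bounded (f ` cball p r)"
    by (meson assms compact_cball compact_continuous_image compact_imp_bounded continuous_on_subset subset_UNIV)
  then obtain B where "\<And>x. x \<in> cball p r \<Longrightarrow> norm (f x) \<le> B"
    unfolding bounded_iff by blast
  then have "\<And>x. x \<in> cball p r \<Longrightarrow> norm (f x) \<le> max B 0" by fastforce
  then show ?thesis using that[of "max B 0"] by auto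
qed

text \<open>The operator norm is dominated by the sum of the norms of the partial derivatives, which
  is continuous and hence bounded on the compact ball.\<close>

lemma C_k_Suc_derivative_bound_cball:
  fixes f :: "'a::euclidean_space \<Rightarrow> 'b::real_normed_vector"
  assumes "C_k (Suc k) f"
  obtains L where "0 \<le> L" "\<And>x. x \<in> cball p r \<Longrightarrow> onorm (frechet_derivative f (at x)) \<le> L"
proof -
  have "continuous_on UNIV (\<lambda>x. \<Sum>e\<in>Basis. norm (frechet_derivative f (at x) e))"
    using assms C_k_continuous by (auto intro!: continuous_on_sum continuous_on_norm)
  then obtain L where L: "0 \<le> L"
    "\<And>x. x \<in> cball p r \<Longrightarrow> norm (\<Sum>e\<in>Basis. norm (frechet_derivative f (at x) e)) \<le> L"
    using continuous_bounded_cball by blast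
  have "onorm (frechet_derivative f (at x)) \<le> L" if "x \<in> cball p r" for x
    using onorm_le_sum_Basis[OF has_derivative_linear[OF C_k_has_derivative[OF assms, of x]]] L(2)[OF that]
    by simp
  with L(1) show ?thesis using that by blast
qed

lemma C_k_Suc_lipschitz_cball:
  fixes f :: "'a::euclidean_space \<Rightarrow> 'b::real_normed_vector"
  assumes "C_k (Suc k) f"
  obtains L where "0 \<le> L"
    "\<And>x y. x \<in> cball p r \<Longrightarrow> y \<in> cball p r \<Longrightarrow> norm (f x - f y) \<le> L * norm (x - y)"
proof -
  obtain L where L: "0 \<le> L" "\<And>x. x \<in> cball p r \<Longrightarrow> onorm (frechet_derivative f (at x)) \<le> L"
    using C_k_Suc_derivative_bound_cball[OF assms] by blast
  then have "norm (f x - f y) \<le> L * norm (x - y)" if "x \<in> cball p r" "y \<in> cball p r" for x y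
    using that C_k_has_derivative[OF assms]
    by (intro differentiable_bound[of "cball p r" f "\<lambda>x. frechet_derivative f (at x)"])
       (auto intro: has_derivative_at_withinI)
  then show ?thesis using that L(1) by blast
qed

lemma smooth_lipschitz_cball:
  fixes f :: "'a::euclidean_space \<Rightarrow> 'b::real_normed_vector"
  assumes "smooth f"
  obtains L where "0 \<le> L"
    "\<And>x y. x \<in> cball p r \<Longrightarrow> y \<in> cball p r \<Longrightarrow> norm (f x - f y) \<le> L * norm (x - y)"
  using C_k_Suc_lipschitz_cball[OF smooth_C_k[OF assms]] by blast

lemma smooth_derivative_bound_cball:
  fixes f :: "'a::euclidean_space \<Rightarrow> 'b::real_normed_vector"
  assumes "smooth f"
  obtains L where "0 \<le> L"
    "\<And>x v. x \<in> cball p r \<Longrightarrow> norm (frechet_derivative f (at x) v) \<le> L * norm v"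
proof -
  obtain L where L: "0 \<le> L" "\<And>x. x \<in> cball p r \<Longrightarrow> onorm (frechet_derivative f (at x)) \<le> L"
    using C_k_Suc_derivative_bound_cball[OF smooth_C_k[OF assms]] by blast
  moreover have "norm (frechet_derivative f (at x) v) \<le> onorm (frechet_derivative f (at x)) * norm v" for x v
    by (rule onorm[OF has_derivative_bounded_linear[OF smooth_has_derivative[OF assms]]])
  ultimately have "norm (frechet_derivative f (at x) v) \<le> L * norm v" if "x \<in> cball p r" for x v
    using that by (meson mult_right_mono norm_ge_zero order_trans)
  with L(1) show ?thesis using that by blast
qed

text \<open>The partial derivatives are themselves Lipschitz on the ball, so along the segment from
  x to y the derivative differs from the one at x by at most a constant times |y - x|. The mean
  value inequality supplies the second factor |y - x|.\<close>

lemma smooth_taylor_cball: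
  fixes f :: "'a::euclidean_space \<Rightarrow> 'b::real_normed_vector"
  assumes "smooth f"
  obtains L where "0 \<le> L"
    "\<And>x y. x \<in> cball p r \<Longrightarrow> y \<in> cball p r \<Longrightarrow>
       norm (f y - f x - frechet_derivative f (at x) (y - x)) \<le> L * (norm (y - x))\<^sup>2"
proof -
  let ?D = "\<lambda>x. frechet_derivative f (at x)"
  have D: "(f has_derivative ?D x) (at x)" for x
    using smooth_has_derivative[OF assms] .
  have "\<exists>L\<ge>0. \<forall>x\<in>cball p r. \<forall>y\<in>cball p r. norm (?D x e - ?D y e) \<le> L * norm (x - y)"
    if "e \<in> Basis" for e
  proof -
    have "C_k (Suc 0) (\<lambda>x. ?D x e)"
      using smooth_C_k[OF assms, of "Suc (Suc 0)"] that unfolding C_k.simps(2)[of "Suc 0"] by blast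
    from C_k_Suc_lipschitz_cball[OF this] show ?thesis by metis
  qed
  then obtain l where l: "\<And>e. e \<in> Basis \<Longrightarrow> 0 \<le> l e"
    "\<And>e x y. e \<in> Basis \<Longrightarrow> x \<in> cball p r \<Longrightarrow> y \<in> cball p r \<Longrightarrow> norm (?D x e - ?D y e) \<le> l e * norm (x - y)"
    by metis
  let ?L = "\<Sum>e\<in>Basis. l e"
  have "norm (f y - f x - ?D x (y - x)) \<le> ?L * (norm (y - x))\<^sup>2"
    if x: "x \<in> cball p r" and y: "y \<in> cball p r" for x y
  proof -
    have seg: "closed_segment x y \<subseteq> cball p r"
      using x y by (simp add: closed_segment_subset)
    have *: "onorm (\<lambda>v. ?D u v - ?D x v) \<le> ?L * norm (y - x)" if "u \<in> closed_segment x y" for u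
    proof -
      have "onorm (\<lambda>v. ?D u v - ?D x v) \<le> (\<Sum>e\<in>Basis. norm (?D u e - ?D x e))"
        by (intro onorm_le_sum_Basis linear_compose_sub has_derivative_linear[OF D])
      also have "\<dots> \<le> (\<Sum>e\<in>Basis. l e * norm (y - x))"
      proof (intro sum_mono)
        fix e :: 'a assume e: "e \<in> Basis"
        have "norm (u - x) \<le> norm (y - x)" using that by (simp add: segment_bound)
        then show "norm (?D u e - ?D x e) \<le> l e * norm (y - x)"
          using l(2)[OF e _ x, of u] that seg l(1)[OF e] by (meson mult_left_mono order_trans subset_iff)
      qed
      finally show ?thesis by (simp add: sum_distrib_right)
    qed
    have "norm (f y - f x - ?D x (y - x)) \<le> norm (y - x) * (?L * norm (y - x))"
    proof (rule differentiable_bound_linearization[where f=f and a=x and b=y and ?x0.0=x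
        and S="closed_segment x y" and f'="?D"])
      show "x + t *\<^sub>R (y - x) \<in> closed_segment x y" if "t \<in> {0..1}" for t
        using that by (auto simp: in_segment algebra_simps intro!: exI[of _ t])
      show "onorm (?D u - ?D x) \<le> ?L * norm (y - x)" if "u \<in> closed_segment x y" for u
        using *[OF that] by (simp add: fun_diff_def)
      show "(f has_derivative ?D u) (at u within closed_segment x y)" for u
        using D by (rule has_derivative_at_withinI)
    qed simp
    then show ?thesis by (simp add: power2_eq_square algebra_simps)
  qed
  moreover have "0 \<le> ?L" using l(1) by (rule sum_nonneg)
  ultimately show ?thesis by (rule that[rotated])
qed

section \<open>Fields tangent to a closed set\<close>

text \<open>A discrete Gronwall inequality, obtained from 1 + \<eta> \<le> exp \<eta>. It
  accumulates the errors of the single Euler steps.\<close>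

lemma affine_recursion_bound:
  fixes a :: "nat \<Rightarrow> real"
  assumes "a 0 \<le> 0" "\<And>i. i < k \<Longrightarrow> a (Suc i) \<le> (1 + \<eta>) * a i + c" "0 \<le> \<eta>" "0 \<le> c"
  shows "a k \<le> real k * c * exp (real k * \<eta>)"
proof -
  have "i \<le> k \<Longrightarrow> a i \<le> real i * c * (1 + \<eta>) ^ i" for i
  proof (induction i)
    case (Suc i)
    have "a (Suc i) \<le> (1 + \<eta>) * (real i * c * (1 + \<eta>) ^ i) + c * 1"
    proof -
      have "(1 + \<eta>) * a i \<le> (1 + \<eta>) * (real i * c * (1 + \<eta>) ^ i)"
        using Suc assms(3) by (intro mult_left_mono) auto
      then show ?thesis using assms(2)[of i] Suc.prems by linarith
    qed
    also have "\<dots> \<le> (1 + \<eta>) * (real i * c * (1 + \<eta>) ^ i) + c * (1 + \<eta>) ^ Suc i"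
      using assms(3,4) one_le_power[of "1 + \<eta>" "Suc i"] by (intro add_left_mono mult_left_mono) auto
    finally show ?case by (simp add: algebra_simps)
  qed (use assms in simp)
  then have "a k \<le> real k * c * (1 + \<eta>) ^ k" by simp
  also have "(1 + \<eta>) ^ k \<le> exp \<eta> ^ k"
    using assms(3) by (intro power_mono) auto
  finally show ?thesis
    using assms(4) by (simp add: exp_of_nat_mult mult_left_mono mult.assoc order_trans)
qed

lemma norm_add_scaleR_add_le:
  "norm (a + s *\<^sub>R (u + v)) \<le> norm a + \<bar>s\<bar> * (norm u + norm v)"
proof -
  have "norm (a + s *\<^sub>R (u + v)) \<le> norm a + \<bar>s\<bar> * norm (u + v)"
    using norm_triangle_ineq[of a "s *\<^sub>R (u + v)"] by simp
  also have "\<dots> \<le> norm a + \<bar>s\<bar> * (norm u + norm v)"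
    by (intro add_left_mono mult_left_mono norm_triangle_ineq) simp
  finally show ?thesis .
qed

lemma norm_add_diff_le:
  fixes a b c :: "'a::real_normed_vector"
  shows "norm (a + b - c) \<le> norm a + norm b + norm c"
  using norm_triangle_ineq4[of "a + b" c] norm_triangle_ineq[of a b] by linarith

text \<open>If \<open>ball z (dist z p)\<close> misses \<open>F \<ni> p\<close>, then \<open>z - p\<close> is an exterior normal of \<open>F\<close> at \<open>p\<close> in the
  sense of Bony.\<close>

definition tangent_to :: "('a::real_inner \<Rightarrow> 'a) \<Rightarrow> 'a set \<Rightarrow> 'a set \<Rightarrow> bool" where
  "tangent_to X F U \<longleftrightarrow>
     (\<forall>p\<in>F \<inter> U. \<forall>z. ball z (dist z p) \<inter> F = {} \<longrightarrow> X p \<bullet> (z - p) = 0)"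

text \<open>At a nearest point q of \<open>F\<close> the field is orthogonal to y - q, so by the
  Lipschitz bound X y . (y - q) is at most L |y - q|^2 in absolute value. Expanding the squared
  distance from the moved point to q gives the estimate. The assumption \<open>near\<close> keeps q
  in the region where the constants are valid.\<close>

lemma infdist_euler_step:
  fixes X :: "'a::euclidean_space \<Rightarrow> 'a"
  assumes "tangent_to X F U" "closed F" "F \<noteq> {}" "S \<subseteq> U" "y \<in> S"
    and near: "\<And>q. q \<in> F \<Longrightarrow> dist y q = infdist y F \<Longrightarrow> q \<in> S"
    and L: "\<And>x y. x \<in> S \<Longrightarrow> y \<in> S \<Longrightarrow> norm (X x - X y) \<le> L * norm (x - y)"
    and B: "norm (X y) \<le> B"
  shows "(infdist (y + s *\<^sub>R X y) F)\<^sup>2 \<le> (1 + 2 * L * \<bar>s\<bar>) * (infdist y F)\<^sup>2 + s\<^sup>2 * B\<^sup>2"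
proof -
  obtain q where q: "q \<in> F" "infdist y F = dist y q"
    using infdist_attains_inf[OF assms(2,3)] by blast
  \<comment> \<open>The ball about \<open>y\<close> reaching to its nearest point misses
    \<open>F\<close>, so y - q is an exterior normal at q and tangency applies.\<close>
  have "ball y (dist y q) \<inter> F = {}"
    using q(2) infdist_le[of _ F y] by fastforce
  moreover have qS: "q \<in> S" using near[OF q(1)] q(2) by simp
  ultimately have 0: "X q \<bullet> (y - q) = 0"
    using assms(1,4) q(1) unfolding tangent_to_def by blast
  have "\<bar>X y \<bullet> (y - q)\<bar> = \<bar>(X y - X q) \<bullet> (y - q)\<bar>" using 0 by (simp add: inner_diff_left)
  also have "\<dots> \<le> norm (X y - X q) * norm (y - q)" by (rule Cauchy_Schwarz_ineq2)
  also have "\<dots> \<le> L * norm (y - q) * norm (y - q)"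
    using L[OF \<open>y \<in> S\<close> qS] by (intro mult_right_mono) auto
  finally have 1: "\<bar>X y \<bullet> (y - q)\<bar> \<le> L * (dist y q)\<^sup>2"
    by (simp add: dist_norm power2_eq_square mult.assoc)
  have "(infdist (y + s *\<^sub>R X y) F)\<^sup>2 \<le> (dist (y + s *\<^sub>R X y) q)\<^sup>2"
    using infdist_le[OF q(1)] by (intro power_mono) (auto simp: infdist_nonneg)
  also have "\<dots> = (y - q + s *\<^sub>R X y) \<bullet> (y - q + s *\<^sub>R X y)"
    by (simp add: dist_norm power2_norm_eq_inner algebra_simps)
  also have "\<dots> = (dist y q)\<^sup>2 + 2 * (s * (X y \<bullet> (y - q))) + s\<^sup>2 * (norm (X y))\<^sup>2"
    unfolding dist_norm power2_norm_eq_inner inner_add_left inner_add_right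
    by (simp add: inner_commute power2_eq_square algebra_simps)
  also have "s * (X y \<bullet> (y - q)) \<le> \<bar>s\<bar> * (L * (dist y q)\<^sup>2)"
    using mult_left_mono[OF 1, of "\<bar>s\<bar>"] abs_ge_self[of "s * (X y \<bullet> (y - q))"]
    by (simp add: abs_mult)
  also have "s\<^sup>2 * (norm (X y))\<^sup>2 \<le> s\<^sup>2 * B\<^sup>2"
    using B by (intro mult_left_mono power_mono) auto
  finally show ?thesis by (simp add: q(2) algebra_simps)
qed

text \<open>The Euler polygon from x has the second-order expansion of the flow and, with enough
  steps, ends as close to \<open>F\<close> as desired. The constants are uniform over base points
  near \<open>p\<close> because the commutator path below applies the estimate at points that vary
  with h.\<close>

lemma tangent_second_order_invariance:
  fixes X :: "'a::euclidean_space \<Rightarrow> 'a"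
  assumes X: "smooth X" and tan: "tangent_to X F U" and F: "closed F" and U: "open U" and p: "p \<in> F \<inter> U"
  obtains C \<delta> where "0 < \<delta>" "0 \<le> C"
    "\<And>x h. x \<in> F \<Longrightarrow> dist x p < \<delta> \<Longrightarrow> \<bar>h\<bar> < \<delta> \<Longrightarrow>
       \<exists>q\<in>F. norm (q - (x + h *\<^sub>R X x + (h\<^sup>2 / 2) *\<^sub>R frechet_derivative X (at x) (X x))) \<le> C * \<bar>h\<bar> ^ 3"
proof -
  let ?D = "\<lambda>x. frechet_derivative X (at x)"
  obtain r0 where r0: "r0 > 0" "cball p r0 \<subseteq> U"
    using U p open_contains_cball by blast
  \<comment> \<open>Starting points lie within r of \<open>p\<close>, the polygon stays within 2r,
    and its nearest points in \<open>F\<close> within 3r; all constants are taken on the ball of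
    radius 4r.\<close>
  define r where "r = r0 / 4"
  have r: "0 < r" "cball p (4 * r) \<subseteq> U" using r0 by (auto simp: r_def)
  let ?S = "cball p (4 * r)"
  obtain B where B: "0 \<le> B" "\<And>x. x \<in> ?S \<Longrightarrow> norm (X x) \<le> B"
    using continuous_bounded_cball[OF C_k_continuous[OF smooth_C_k[OF X]]] by blast
  obtain L where L: "0 \<le> L" "\<And>x y. x \<in> ?S \<Longrightarrow> y \<in> ?S \<Longrightarrow> norm (X x - X y) \<le> L * norm (x - y)"
    using smooth_lipschitz_cball[OF X] by blast
  obtain T where T: "0 \<le> T"
    "\<And>x y. x \<in> ?S \<Longrightarrow> y \<in> ?S \<Longrightarrow> norm (X y - X x - ?D x (y - x)) \<le> T * (norm (y - x))\<^sup>2"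
    using smooth_taylor_cball[OF X] by blast
  obtain M where M: "0 \<le> M" "\<And>x v. x \<in> ?S \<Longrightarrow> norm (?D x v) \<le> M * norm v"
    using smooth_derivative_bound_cball[OF X] by blast
  define C where "C = T * B\<^sup>2 + M * (L * B)"
  have C0: "0 \<le> C" using T L B M by (simp add: C_def)
  \<comment> \<open>The second entry gives |h| B \<le> r, which bounds the total length of the
    polygon.\<close>
  define \<delta> where "\<delta> = min r (r / (B + 1))"
  have \<delta>: "0 < \<delta>" using r B by (auto simp: \<delta>_def)
  \<comment> \<open>Of the additional 2, one unit pays for moving from the end of the polygon to
    \<open>F\<close>, the other for its incomplete second-order coefficient.\<close>
  have "\<exists>q\<in>F. norm (q - (x + h *\<^sub>R X x + (h\<^sup>2 / 2) *\<^sub>R ?D x (X x))) \<le> (C + 2) * \<bar>h\<bar> ^ 3"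
    if x: "x \<in> F" "dist x p < \<delta>" and h: "\<bar>h\<bar> < \<delta>" for x h
  proof (cases "h = 0")
    case True
    then show ?thesis using x by force
  next
    case False
    have "\<bar>h\<bar> * B \<le> r / (B + 1) * (B + 1)"
      using h B r by (intro mult_mono) (auto simp: \<delta>_def)
    then have hB: "\<bar>h\<bar> * B \<le> r" using B by simp
    have xr: "dist x p < r" using x by (simp add: \<delta>_def)
    then have xS: "x \<in> ?S" using r by (simp add: dist_commute)
    define A where "A = ?D x (X x)"
    have lin: "linear (?D x)" using smooth_has_derivative[OF X] has_derivative_linear by blast
    \<comment> \<open>The first summand controls the distance of the end point from
      \<open>F\<close>, the second the term h^2/(2k) \<open>A\<close> missing from the polygon's
      expansion, and the 1 makes \<open>k\<close> positive.\<close>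
    obtain k :: nat where k: "B\<^sup>2 * exp (2 * L * \<bar>h\<bar>) / h ^ 4 + norm A / \<bar>h\<bar> + 1 < real k"
      using reals_Archimedean2 by blast
    have knn: "0 \<le> B\<^sup>2 * exp (2 * L * \<bar>h\<bar>) / h ^ 4" "0 \<le> norm A / \<bar>h\<bar>" by auto
    have k1: "1 < real k" "B\<^sup>2 * exp (2 * L * \<bar>h\<bar>) / h ^ 4 \<le> real k" "norm A / \<bar>h\<bar> \<le> real k"
      using k knn by linarith+
    define s where "s = h / real k"
    have ks: "real k * s = h" using k1 by (simp add: s_def)
    define y where "y i = ((\<lambda>u. u + s *\<^sub>R X u) ^^ i) x" for i
    have y0: "y 0 = x" and ySuc: "\<And>i. y (Suc i) = y i + s *\<^sub>R X (y i)" by (simp_all add: y_def)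
    have isk: "real i * \<bar>s\<bar> \<le> \<bar>h\<bar>" if "i \<le> k" for i
      using that k1 mult_right_mono[of "real i" "real k" "\<bar>s\<bar>"] by (simp add: ks[symmetric] abs_mult)
    have near: "norm (y i - x) \<le> real i * \<bar>s\<bar> * B \<and> y i \<in> cball p (2 * r)" if "i \<le> k" for i
      using that
    proof (induction i)
      case 0
      then show ?case using xr r by (simp add: y0 dist_commute)
    next
      case (Suc i)
      have "y i \<in> ?S" using Suc r by auto
      have "norm (y (Suc i) - x) \<le> norm (y i - x) + norm (s *\<^sub>R X (y i))"
        unfolding ySuc using norm_triangle_ineq[of "y i - x" "s *\<^sub>R X (y i)"] by (simp add: algebra_simps)
      also have "\<dots> \<le> real i * \<bar>s\<bar> * B + \<bar>s\<bar> * B"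
        using Suc B(2)[OF \<open>y i \<in> ?S\<close>] by (auto intro!: add_mono mult_left_mono)
      finally have 1: "norm (y (Suc i) - x) \<le> real (Suc i) * \<bar>s\<bar> * B" by (simp add: algebra_simps)
      also have "\<dots> \<le> \<bar>h\<bar> * B" using isk[OF Suc.prems] B by (intro mult_right_mono) auto
      finally have "norm (y (Suc i) - x) \<le> r" using hB by simp
      then have "dist p (y (Suc i)) \<le> 2 * r"
        using dist_triangle[of p "y (Suc i)" x] xr by (simp add: dist_norm norm_minus_commute)
      with 1 show ?case by simp
    qed
    have yS: "y i \<in> ?S" if "i \<le> k" for i using near[OF that] r by auto
    have yx: "norm (y i - x) \<le> r" if "i \<le> k" for i
      using near[OF that] mult_right_mono[OF isk[OF that] B(1)] hB by linarith
    \<comment> \<open>\<open>y\<close> is the Euler polygon of \<open>X\<close> with \<open>k\<close> steps of length \<open>s = h / k\<close>; \<open>k\<close> was chosen so large that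
      its end point is within \<open>\<bar>h\<bar>\<^sup>3\<close> of \<open>F\<close>.\<close>
    have "(infdist (y k) F)\<^sup>2 \<le> real k * (s\<^sup>2 * B\<^sup>2) * exp (real k * (2 * L * \<bar>s\<bar>))"
    proof (rule affine_recursion_bound[where a="\<lambda>i. (infdist (y i) F)\<^sup>2"])
      show "(infdist (y 0) F)\<^sup>2 \<le> 0" using x by (simp add: y0)
      show "(infdist (y (Suc i)) F)\<^sup>2 \<le> (1 + 2 * L * \<bar>s\<bar>) * (infdist (y i) F)\<^sup>2 + s\<^sup>2 * B\<^sup>2" if "i < k" for i
        unfolding ySuc
      proof (rule infdist_euler_step[OF tan F _ r(2)])
        show "F \<noteq> {}" using x by blast
        show "y i \<in> ?S" "norm (X (y i)) \<le> B" using that B yS by simp_all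
        \<comment> \<open>Since \<open>x\<close> itself belongs to \<open>F\<close>, a nearest point
          is no farther from \<open>y i\<close> than \<open>x\<close> is.\<close>
        show "q \<in> ?S" if "q \<in> F" "dist (y i) q = infdist (y i) F" for q
        proof -
          have "dist (y i) q \<le> r" using that(2) infdist_le[OF x(1), of "y i"] yx[of i] \<open>i < k\<close> by (simp add: dist_norm)
          then show ?thesis using near[of i] \<open>i < k\<close> dist_triangle[of p q "y i"] r by simp
        qed
      qed (use L in auto)
    qed (use L in auto)
    also have "\<dots> = B\<^sup>2 * exp (2 * L * \<bar>h\<bar>) / h ^ 4 * (h ^ 6 / real k)"
      using k1 False by (simp add: s_def field_simps power2_eq_square eval_nat_numeral)
    also have "\<dots> \<le> real k * (h ^ 6 / real k)"
      using k1 by (intro mult_right_mono) auto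
    also have "\<dots> = (\<bar>h\<bar> ^ 3)\<^sup>2" using k1 by (simp add: power_mult[symmetric] power_abs)
    finally have inf: "infdist (y k) F \<le> \<bar>h\<bar> ^ 3" by (rule power2_le_imp_le) simp
    \<comment> \<open>By the Lipschitz bound step i contributes at most L B s^2 i, and i^2 + i \<le>
      (i + 1)^2 closes the induction.\<close>
    have first: "norm (y i - x - (real i * s) *\<^sub>R X x) \<le> L * B * (real i * s)\<^sup>2" if "i \<le> k" for i
      using that
    proof (induction i)
      case (Suc i)
      have "y (Suc i) - x - (real (Suc i) * s) *\<^sub>R X x
          = (y i - x - (real i * s) *\<^sub>R X x) + s *\<^sub>R (X (y i) - X x)"
        by (simp add: ySuc algebra_simps)
      then have "norm (y (Suc i) - x - (real (Suc i) * s) *\<^sub>R X x)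
          \<le> norm (y i - x - (real i * s) *\<^sub>R X x) + \<bar>s\<bar> * norm (X (y i) - X x)"
        using norm_triangle_ineq by (metis norm_scaleR)
      also have "\<dots> \<le> L * B * (real i * s)\<^sup>2 + \<bar>s\<bar> * (L * (real i * \<bar>s\<bar> * B))"
        using Suc near[of i] L(1) L(2)[OF yS[of i] xS]
        by (intro add_mono mult_left_mono) (auto intro: order_trans mult_left_mono)
      also have "\<dots> = L * B * (s\<^sup>2 * ((real i)\<^sup>2 + real i))"
        by (simp add: algebra_simps power2_eq_square)
      also have "\<dots> \<le> L * B * (s\<^sup>2 * (real (Suc i))\<^sup>2)"
        using L B by (intro mult_left_mono) (auto simp: power2_eq_square algebra_simps)
      finally show ?case by (simp add: power_mult_distrib mult.commute)
    qed (simp add: y0)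
    \<comment> \<open>Step i adds s^2 i to the coefficient of \<open>A\<close>, so after i steps it
      is s^2 (0 + ... + (i - 1)) = s^2 i(i - 1)/2.\<close>
    have second: "norm (y i - x - (real i * s) *\<^sub>R X x - (s\<^sup>2 * (real i * (real i - 1) / 2)) *\<^sub>R A)
        \<le> real i * \<bar>s\<bar> * (h\<^sup>2 * C)" if "i \<le> k" for i
      using that
    proof (induction i)
      case (Suc i)
      \<comment> \<open>\<open>?R\<close> is the Taylor remainder of the field; \<open>?Q\<close> is
        the error of replacing y_i - x by its first-order part under the derivative, which
        \<open>first\<close> controls.\<close>
      let ?R = "X (y i) - X x - ?D x (y i - x)" and ?Q = "?D x (y i - x - (real i * s) *\<^sub>R X x)"
      have his: "(real i * s)\<^sup>2 \<le> h\<^sup>2"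
        using power_mono[OF isk[of i], of 2] Suc.prems by (simp add: power_mult_distrib)
      have Q: "?Q = ?D x (y i - x) - (real i * s) *\<^sub>R A"
        by (simp add: A_def linear_diff[OF lin] linear_scale[OF lin])
      have "y (Suc i) - x - (real (Suc i) * s) *\<^sub>R X x - (s\<^sup>2 * (real (Suc i) * (real (Suc i) - 1) / 2)) *\<^sub>R A
          = (y i - x - (real i * s) *\<^sub>R X x - (s\<^sup>2 * (real i * (real i - 1) / 2)) *\<^sub>R A) + s *\<^sub>R (?R + ?Q)"
      proof -
        have "s\<^sup>2 * (real (Suc i) * (real (Suc i) - 1) / 2) = s\<^sup>2 * (real i * (real i - 1) / 2) + s * (real i * s)"
          by (simp add: field_simps power2_eq_square)
        moreover have "y (Suc i) - x - (real (Suc i) * s) *\<^sub>R X x - (a + s * (real i * s)) *\<^sub>R A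
          = (y i - x - (real i * s) *\<^sub>R X x - a *\<^sub>R A) + s *\<^sub>R (?R + ?Q)" for a
          unfolding Q ySuc by (simp add: algebra_simps)
        ultimately show ?thesis by (simp only:)
      qed
      then have "norm (y (Suc i) - x - (real (Suc i) * s) *\<^sub>R X x - (s\<^sup>2 * (real (Suc i) * (real (Suc i) - 1) / 2)) *\<^sub>R A)
          \<le> norm (y i - x - (real i * s) *\<^sub>R X x - (s\<^sup>2 * (real i * (real i - 1) / 2)) *\<^sub>R A) + \<bar>s\<bar> * (norm ?R + norm ?Q)"
        using norm_add_scaleR_add_le by (simp only:)
      also have "\<dots> \<le> real i * \<bar>s\<bar> * (h\<^sup>2 * C) + \<bar>s\<bar> * (h\<^sup>2 * C)"
      proof (intro add_mono mult_left_mono)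
        show "norm (y i - x - (real i * s) *\<^sub>R X x - (s\<^sup>2 * (real i * (real i - 1) / 2)) *\<^sub>R A)
          \<le> real i * \<bar>s\<bar> * (h\<^sup>2 * C)" using Suc by simp
        have "norm (y i - x) \<le> \<bar>h\<bar> * B"
          using near[of i] isk[of i] Suc.prems mult_right_mono[OF _ B(1)] by (meson Suc_leD order_trans)
        then have "(norm (y i - x))\<^sup>2 \<le> (\<bar>h\<bar> * B)\<^sup>2" by (rule power_mono) simp
        then have "(norm (y i - x))\<^sup>2 \<le> h\<^sup>2 * B\<^sup>2" by (simp add: power_mult_distrib)
        then have "norm ?R \<le> T * (h\<^sup>2 * B\<^sup>2)"
          using T(2)[OF xS yS[of i]] T(1) Suc.prems by (meson Suc_leD mult_left_mono order_trans)
        moreover have "norm ?Q \<le> M * (L * B * h\<^sup>2)"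
        proof -
          have "norm ?Q \<le> M * norm (y i - x - (real i * s) *\<^sub>R X x)" by (rule M(2)[OF xS])
          also have "\<dots> \<le> M * (L * B * (real i * s)\<^sup>2)"
            using first[of i] Suc.prems M(1) by (intro mult_left_mono) auto
          also have "\<dots> \<le> M * (L * B * h\<^sup>2)" using his M L B by (intro mult_left_mono) auto
          finally show ?thesis .
        qed
        ultimately show "norm ?R + norm ?Q \<le> h\<^sup>2 * C" by (simp add: C_def algebra_simps)
      qed simp
      finally show ?case by (simp add: algebra_simps)
    qed (simp add: y0)
    \<comment> \<open>At i = k the coefficient falls short of h^2/2 by h^2/(2k); the choice of
      \<open>k\<close> makes this deficit negligible.\<close>
    have s2: "s\<^sup>2 * (real k * (real k - 1) / 2) = h\<^sup>2 / 2 - h\<^sup>2 / (2 * real k)"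
      using k1 by (simp add: s_def field_simps power2_eq_square)
    have "norm (y k - x - h *\<^sub>R X x - (h\<^sup>2 / 2 - h\<^sup>2 / (2 * real k)) *\<^sub>R A) \<le> \<bar>h\<bar> * (h\<^sup>2 * C)"
      using second[of k] k1 unfolding s2 ks by (simp add: s_def)
    also have "\<dots> = C * \<bar>h\<bar> ^ 3" by (simp add: power3_eq_cube power2_eq_square)
    finally have sec: "norm (y k - x - h *\<^sub>R X x - (h\<^sup>2 / 2 - h\<^sup>2 / (2 * real k)) *\<^sub>R A) \<le> C * \<bar>h\<bar> ^ 3" .
    have "norm ((h\<^sup>2 / (2 * real k)) *\<^sub>R A) \<le> \<bar>h\<bar> ^ 3"
    proof -
      have "norm ((h\<^sup>2 / (2 * real k)) *\<^sub>R A) = h\<^sup>2 * \<bar>h\<bar> * (norm A / \<bar>h\<bar>) / (2 * real k)"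
        using False by simp
      also have "\<dots> \<le> h\<^sup>2 * \<bar>h\<bar> * real k / (2 * real k)"
        using k1 by (intro divide_right_mono mult_left_mono) auto
      also have "\<dots> = \<bar>h\<bar> ^ 3 / 2" using k1 by (simp add: power3_eq_cube power2_eq_square)
      also have "\<dots> \<le> \<bar>h\<bar> ^ 3" by simp
      finally show ?thesis .
    qed
    moreover obtain q where q: "q \<in> F" "infdist (y k) F = dist (y k) q"
      using infdist_attains_inf[OF F] x by blast
    moreover have "q - (x + h *\<^sub>R X x + (h\<^sup>2 / 2) *\<^sub>R A) =
       (q - y k) + (y k - x - h *\<^sub>R X x - (h\<^sup>2 / 2 - h\<^sup>2 / (2 * real k)) *\<^sub>R A) - (h\<^sup>2 / (2 * real k)) *\<^sub>R A"
      by (simp add: algebra_simps)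
    then have "norm (q - (x + h *\<^sub>R X x + (h\<^sup>2 / 2) *\<^sub>R A)) \<le>
       norm (q - y k) + norm (y k - x - h *\<^sub>R X x - (h\<^sup>2 / 2 - h\<^sup>2 / (2 * real k)) *\<^sub>R A) + norm ((h\<^sup>2 / (2 * real k)) *\<^sub>R A)"
      using norm_add_diff_le by (simp only:)
    moreover have "norm (q - y k) \<le> \<bar>h\<bar> ^ 3"
      using inf q by (simp add: dist_norm norm_minus_commute)
    ultimately have "norm (q - (x + h *\<^sub>R X x + (h\<^sup>2 / 2) *\<^sub>R A)) \<le> (C + 2) * \<bar>h\<bar> ^ 3"
      using sec by (simp add: algebra_simps)
    then show ?thesis using q(1) A_def by blast
  qed
  then show ?thesis using that[of \<delta> "C + 2"] \<delta> C0 by auto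
qed

section \<open>Closure under Lie brackets\<close>

text \<open>This is Landau's O(h^n) as h tends to 0 from the right, not o(h^n).\<close>

definition small_order :: "nat \<Rightarrow> (real \<Rightarrow> 'a::real_normed_vector) \<Rightarrow> bool" where
  "small_order n f \<longleftrightarrow> (\<exists>C\<ge>0. \<forall>\<^sub>F h in at_right 0. norm (f h) \<le> C * h ^ n)"

lemma eventually_at_right_0_less_1: "\<forall>\<^sub>F h in at_right (0::real). 0 < h \<and> h < 1"
  unfolding eventually_at_right_field by (auto intro: exI[of _ 1])

lemma small_order_add:
  assumes "small_order n f" "small_order n g"
  shows "small_order n (\<lambda>h. f h + g h)"
proof -
  obtain C D where C: "C \<ge> 0" "\<forall>\<^sub>F h in at_right 0. norm (f h) \<le> C * h ^ n"
    and D: "D \<ge> 0" "\<forall>\<^sub>F h in at_right 0. norm (g h) \<le> D * h ^ n"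
    using assms unfolding small_order_def by blast
  from C(2) D(2) have "\<forall>\<^sub>F h in at_right 0. norm (f h + g h) \<le> (C + D) * h ^ n"
  proof eventually_elim
    case (elim h)
    then show ?case using norm_triangle_ineq[of "f h" "g h"] by (simp add: distrib_right)
  qed
  then show ?thesis unfolding small_order_def using C D by (meson add_nonneg_nonneg)
qed

lemma small_order_compare:
  assumes "\<forall>\<^sub>F h in at_right 0. norm (g h) \<le> M * norm (f h) ^ k" "small_order n f" "0 \<le> M"
  shows "small_order (n * k) g"
proof -
  obtain C where C: "C \<ge> 0" "\<forall>\<^sub>F h in at_right 0. norm (f h) \<le> C * h ^ n"
    using assms unfolding small_order_def by blast
  from C(2) assms(1) have "\<forall>\<^sub>F h in at_right 0. norm (g h) \<le> (M * C ^ k) * h ^ (n * k)"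
  proof eventually_elim
    case (elim h)
    have "norm (f h) ^ k \<le> (C * h ^ n) ^ k" using elim by (intro power_mono) auto
    from mult_left_mono[OF this \<open>0 \<le> M\<close>] elim show ?case
      by (simp add: power_mult_distrib power_mult mult.assoc)
  qed
  moreover have "0 \<le> M * C ^ k" using C assms(3) by simp
  ultimately show ?thesis unfolding small_order_def by blast
qed

lemma small_order_power: "small_order n (\<lambda>h. h ^ n *\<^sub>R v)"
proof -
  from eventually_at_right_0_less_1
  have "\<forall>\<^sub>F h in at_right 0. norm (h ^ n *\<^sub>R v) \<le> norm v * h ^ n"
    by eventually_elim (simp add: power_abs)
  then show ?thesis unfolding small_order_def by (meson norm_ge_zero)
qed

lemma small_order_bound:
  assumes "small_order n f" "0 \<le> M" "\<And>h. norm (g h) \<le> M * norm (f h)"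
  shows "small_order n g"
  using small_order_compare[of g M f 1 n] assms by simp

lemma small_order_scaleR: "small_order n f \<Longrightarrow> small_order n (\<lambda>h. c *\<^sub>R f h)"
  by (rule small_order_bound[of n f "\<bar>c\<bar>"]) auto

lemma small_order_diff:
  "small_order n f \<Longrightarrow> small_order n g \<Longrightarrow> small_order n (\<lambda>h. f h - g h)"
  using small_order_add[of n f "\<lambda>h. (-1) *\<^sub>R g h"] small_order_scaleR[of n g "-1"] by simp

lemma small_order_times_h:
  assumes "small_order n f" shows "small_order (Suc n) (\<lambda>h. h *\<^sub>R f h)"
proof -
  obtain C where C: "C \<ge> 0" "\<forall>\<^sub>F h in at_right 0. norm (f h) \<le> C * h ^ n"
    using assms unfolding small_order_def by blast
  from C(2) eventually_at_right_0_less_1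
  have "\<forall>\<^sub>F h in at_right 0. norm (h *\<^sub>R f h) \<le> C * h ^ Suc n"
  proof eventually_elim
    case (elim h)
    then show ?case using mult_left_mono[of "norm (f h)" "C * h ^ n" h] by (simp add: mult_ac)
  qed
  with C show ?thesis unfolding small_order_def by blast
qed

lemma small_order_mono:
  assumes "small_order n f" "m \<le> n" shows "small_order m f"
proof -
  obtain C where C: "C \<ge> 0" "\<forall>\<^sub>F h in at_right 0. norm (f h) \<le> C * h ^ n"
    using assms unfolding small_order_def by blast
  from C(2) eventually_at_right_0_less_1
  have "\<forall>\<^sub>F h in at_right 0. norm (f h) \<le> C * h ^ m"
  proof eventually_elim
    case (elim h)
    then have "h ^ n \<le> h ^ m" using assms(2) by (intro power_decreasing) auto
    then show ?case using elim mult_left_mono[OF _ C(1)] by (meson order_trans)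
  qed
  with C show ?thesis unfolding small_order_def by blast
qed

lemma small_order_1_eventually_less:
  assumes "small_order 1 f" "0 < e" shows "\<forall>\<^sub>F h in at_right 0. norm (f h) < e"
proof -
  obtain C where C: "C \<ge> 0" "\<forall>\<^sub>F h in at_right 0. norm (f h) \<le> C * h ^ 1"
    using assms unfolding small_order_def by blast
  have "((\<lambda>h. C * h) \<longlongrightarrow> C * 0) (at_right 0)" by (intro tendsto_intros)
  then have "\<forall>\<^sub>F h in at_right 0. C * h < e" using assms(2) by (intro order_tendstoD) auto
  with C(2) show ?thesis by eventually_elim simp
qed

text \<open>One leg of the commutator path: a path in \<open>F\<close> with velocity
  \<open>u\<close> at \<open>p\<close> is moved by h along \<open>X\<close> or, for c = -1, against
  it. As X(q h) is multiplied by h, its variation h DX(p) u must be kept, while the second-order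
  term may be frozen at \<open>p\<close>.\<close>

lemma tangent_second_order_step:
  fixes X :: "'a::euclidean_space \<Rightarrow> 'a"
  assumes X: "smooth X" and tan: "tangent_to X F U" and F: "closed F" and U: "open U" and p: "p \<in> F \<inter> U"
    and qF: "\<forall>\<^sub>F h in at_right 0. q h \<in> F"
    and q2: "small_order 2 (\<lambda>h. q h - p - h *\<^sub>R u)" and c: "\<bar>c\<bar> = 1"
  obtains q' where "\<forall>\<^sub>F h in at_right 0. q' h \<in> F"
    "small_order 3 (\<lambda>h. q' h - q h - (c * h) *\<^sub>R (X p + h *\<^sub>R frechet_derivative X (at p) u)
       - (h\<^sup>2 / 2) *\<^sub>R frechet_derivative X (at p) (X p))"
proof -
  let ?D = "frechet_derivative X (at p)" and ?G = "\<lambda>x. frechet_derivative X (at x) (X x)"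
  obtain C \<delta> where \<delta>: "0 < \<delta>" "0 \<le> C"
    and step: "\<And>x h. x \<in> F \<Longrightarrow> dist x p < \<delta> \<Longrightarrow> \<bar>h\<bar> < \<delta> \<Longrightarrow>
       \<exists>q\<in>F. norm (q - (x + h *\<^sub>R X x + (h\<^sup>2 / 2) *\<^sub>R ?G x)) \<le> C * \<bar>h\<bar> ^ 3"
    by (rule tangent_second_order_invariance[OF X tan F U p]) blast
  have lin: "linear ?D" using smooth_has_derivative[OF X] has_derivative_linear by blast
  have q1: "small_order 1 (\<lambda>h. q h - p)"
    using small_order_add[OF small_order_mono[OF q2, of 1] small_order_power[of 1 u]] by simp
  have near: "\<forall>\<^sub>F h in at_right 0. norm (q h - p) < min \<delta> 1"
    by (rule small_order_1_eventually_less[OF q1]) (use \<delta> in simp)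
  have h0: "\<forall>\<^sub>F h in at_right 0. h < \<delta>"
    using \<delta>(1) eventually_at_right_real[of 0 \<delta>] by (auto elim: eventually_mono)
  define q' where "q' h = (SOME y. y \<in> F \<and>
    norm (y - (q h + (c * h) *\<^sub>R X (q h) + ((c * h)\<^sup>2 / 2) *\<^sub>R ?G (q h))) \<le> C * \<bar>c * h\<bar> ^ 3)" for h
  from qF near h0 eventually_at_right_0_less_1
  have ev: "\<forall>\<^sub>F h in at_right 0. q' h \<in> F \<and>
    norm (q' h - (q h + (c * h) *\<^sub>R X (q h) + ((c * h)\<^sup>2 / 2) *\<^sub>R ?G (q h))) \<le> C * \<bar>c * h\<bar> ^ 3"
  proof eventually_elim
    case (elim h)
    have "\<bar>c * h\<bar> < \<delta>" using elim c by (simp add: abs_mult)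
    then have "\<exists>y. y \<in> F \<and>
      norm (y - (q h + (c * h) *\<^sub>R X (q h) + ((c * h)\<^sup>2 / 2) *\<^sub>R ?G (q h))) \<le> C * \<bar>c * h\<bar> ^ 3"
      using step[of "q h" "c * h"] elim by (auto simp: dist_norm)
    then show ?case unfolding q'_def by (rule someI_ex)
  qed
  have c2: "c\<^sup>2 = 1" using c by (metis power2_abs one_power2)
  \<comment> \<open>The four errors are the defect of the invariance estimate, the Taylor remainder
    of \<open>X\<close> at \<open>p\<close>, the replacement of q h - p by h u, and the freezing of
    the second-order coefficient. Their weights 1, h, h and h^2 bring each of them to order
    3.\<close>
  let ?E1 = "\<lambda>h. q' h - (q h + (c * h) *\<^sub>R X (q h) + ((c * h)\<^sup>2 / 2) *\<^sub>R ?G (q h))"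
  let ?E2 = "\<lambda>h. X (q h) - X p - ?D (q h - p)"
  let ?E3 = "\<lambda>h. ?D (q h - p - h *\<^sub>R u)"
  let ?E4 = "\<lambda>h. ?G (q h) - ?G p"
  from ev eventually_at_right_0_less_1 have "\<forall>\<^sub>F h in at_right 0. norm (?E1 h) \<le> C * h ^ 3"
    by eventually_elim (use c in \<open>simp add: abs_mult\<close>)
  then have E1: "small_order 3 ?E1" using \<delta>(2) unfolding small_order_def by blast
  have pS: "p \<in> cball p 1" by simp
  from near have qS: "\<forall>\<^sub>F h in at_right 0. q h \<in> cball p 1"
    by eventually_elim (simp add: dist_norm norm_minus_commute)
  obtain T where T: "0 \<le> T" "\<And>x y. x \<in> cball p 1 \<Longrightarrow> y \<in> cball p 1 \<Longrightarrow>
      norm (X y - X x - frechet_derivative X (at x) (y - x)) \<le> T * (norm (y - x))\<^sup>2"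
    using smooth_taylor_cball[OF X] by blast
  from qS have "\<forall>\<^sub>F h in at_right 0. norm (?E2 h) \<le> T * norm (q h - p) ^ 2"
    by eventually_elim (rule T(2)[OF pS])
  from small_order_compare[OF this q1 T(1)] have E2: "small_order 2 ?E2" by simp
  obtain M where M: "0 \<le> M" "\<And>x v. x \<in> cball p 1 \<Longrightarrow> norm (frechet_derivative X (at x) v) \<le> M * norm v"
    using smooth_derivative_bound_cball[OF X] by blast
  have E3: "small_order 2 ?E3"
    by (rule small_order_bound[OF q2 M(1)]) (rule M(2)[OF pS])
  obtain L where L: "0 \<le> L"
    "\<And>x y. x \<in> cball p 1 \<Longrightarrow> y \<in> cball p 1 \<Longrightarrow> norm (?G x - ?G y) \<le> L * norm (x - y)"
    using smooth_lipschitz_cball[OF smooth_directional_derivative[OF X X]] by blast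
  from qS have "\<forall>\<^sub>F h in at_right 0. norm (?E4 h) \<le> L * norm (q h - p) ^ 1"
    unfolding power_one_right by eventually_elim (rule L(2)[OF _ pS])
  from small_order_compare[OF this q1 L(1)] have E4: "small_order 1 ?E4" by simp
  have "small_order 3 (\<lambda>h. ?E1 h + h *\<^sub>R (c *\<^sub>R (?E2 h + ?E3 h)) + h *\<^sub>R (h *\<^sub>R ((1/2) *\<^sub>R ?E4 h)))"
    using E1 small_order_times_h[OF small_order_scaleR[OF small_order_add[OF E2 E3], of c]]
      small_order_times_h[OF small_order_times_h[OF small_order_scaleR[OF E4, of "1/2"]]]
    by (intro small_order_add) (simp_all add: numeral_3_eq_3 numeral_2_eq_2)
  also have "(\<lambda>h. ?E1 h + h *\<^sub>R (c *\<^sub>R (?E2 h + ?E3 h)) + h *\<^sub>R (h *\<^sub>R ((1/2) *\<^sub>R ?E4 h)))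
    = (\<lambda>h. q' h - q h - (c * h) *\<^sub>R (X p + h *\<^sub>R ?D u) - (h\<^sup>2 / 2) *\<^sub>R ?D (X p))"
  proof
    fix h
    have e: "?E3 h = ?D (q h - p) - h *\<^sub>R ?D u"
      by (simp only: linear_diff[OF lin, of "q h - p"] linear_scale[OF lin])
    show "?E1 h + h *\<^sub>R (c *\<^sub>R (?E2 h + ?E3 h)) + h *\<^sub>R (h *\<^sub>R ((1/2) *\<^sub>R ?E4 h))
      = q' h - q h - (c * h) *\<^sub>R (X p + h *\<^sub>R ?D u) - (h\<^sup>2 / 2) *\<^sub>R ?D (X p)"
      unfolding e power_mult_distrib c2 by (simp add: algebra_simps power2_eq_square)
  qed
  finally show ?thesis by (rule that[rotated]) (rule eventually_mono[OF ev], blast)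
qed

text \<open>Along the closed-up commutator path \<open>X, Y, -X, -Y\<close> the first-order terms cancel, and the
  endpoint, which lies in \<open>F\<close>, is \<open>p + h\<^sup>2 [X,Y](p) + O(h\<^sup>3)\<close>.\<close>

lemma tangent_commutator_le:
  fixes X Y :: "'a::euclidean_space \<Rightarrow> 'a"
  assumes X: "smooth X" "tangent_to X F U" and Y: "smooth Y" "tangent_to Y F U"
    and F: "closed F" and U: "open U" and p: "p \<in> F \<inter> U" and z: "ball z (dist z p) \<inter> F = {}"
  shows "(frechet_derivative Y (at p) (X p) - frechet_derivative X (at p) (Y p)) \<bullet> (z - p) \<le> 0"
proof -
  let ?DX = "frechet_derivative X (at p)" and ?DY = "frechet_derivative Y (at p)"
  let ?Z = "?DY (X p) - ?DX (Y p)"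
  have linX: "linear ?DX" and linY: "linear ?DY"
    using smooth_has_derivative X Y has_derivative_linear by blast+
  note stepX = tangent_second_order_step[OF X F U p] and stepY = tangent_second_order_step[OF Y F U p]
  have h2: "small_order 2 (\<lambda>h. h\<^sup>2 *\<^sub>R v)" for v :: 'a
    by (rule small_order_power)
  \<comment> \<open>Each leg yields an expansion with error O(h^3); dropping its h^2 term gives the
    velocity expansion that the next leg requires.\<close>
  have lower: "small_order 2 f" if "small_order 3 (\<lambda>h. f h - h\<^sup>2 *\<^sub>R v)" for f and v :: 'a
    using small_order_add[OF small_order_mono[OF that, of 2] h2[of v]] by simp
  \<comment> \<open>The first leg starts from the constant path at \<open>p\<close>, whose velocity
    is 0.\<close>
  have "\<forall>\<^sub>F h in at_right 0. (\<lambda>h::real. p) h \<in> F" using p by simp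
  moreover have "small_order 2 (\<lambda>h. (\<lambda>h::real. p) h - p - h *\<^sub>R (0::'a))"
    using small_order_power[of 2 "0::'a"] by simp
  ultimately obtain q1 where q1: "\<forall>\<^sub>F h in at_right 0. q1 h \<in> F" and
    1: "small_order 3 (\<lambda>h. q1 h - p - (1 * h) *\<^sub>R (X p + h *\<^sub>R ?DX 0) - (h\<^sup>2 / 2) *\<^sub>R ?DX (X p))"
    by (rule stepX[where c=1]) auto
  have e1: "small_order 3 (\<lambda>h. q1 h - p - h *\<^sub>R X p - h\<^sup>2 *\<^sub>R ((1/2) *\<^sub>R ?DX (X p)))"
    using 1 by (simp add: linear_0[OF linX])
  obtain q2 where q2: "\<forall>\<^sub>F h in at_right 0. q2 h \<in> F" and
    2: "small_order 3 (\<lambda>h. q2 h - q1 h - (1 * h) *\<^sub>R (Y p + h *\<^sub>R ?DY (X p)) - (h\<^sup>2 / 2) *\<^sub>R ?DY (Y p))"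
    by (rule stepY[OF q1 lower[OF e1], where c=1]) auto
  let ?A2 = "(1/2) *\<^sub>R ?DX (X p) + ?DY (X p) + (1/2) *\<^sub>R ?DY (Y p)"
  have e2: "small_order 3 (\<lambda>h. q2 h - p - h *\<^sub>R (X p + Y p) - h\<^sup>2 *\<^sub>R ?A2)"
    using small_order_add[OF e1 2] by (simp add: algebra_simps power2_eq_square)
  obtain q3 where q3: "\<forall>\<^sub>F h in at_right 0. q3 h \<in> F" and
    3: "small_order 3 (\<lambda>h. q3 h - q2 h - (-1 * h) *\<^sub>R (X p + h *\<^sub>R ?DX (X p + Y p)) - (h\<^sup>2 / 2) *\<^sub>R ?DX (X p))"
    by (rule stepX[OF q2 lower[OF e2], where c="-1"]) auto
  let ?A3 = "?DY (X p) + (1/2) *\<^sub>R ?DY (Y p) - ?DX (Y p)"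
  have "(q2 h - p - h *\<^sub>R (X p + Y p) - h\<^sup>2 *\<^sub>R ?A2) +
      (q3 h - q2 h - (-1 * h) *\<^sub>R (X p + h *\<^sub>R ?DX (X p + Y p)) - (h\<^sup>2 / 2) *\<^sub>R ?DX (X p))
      = q3 h - p - h *\<^sub>R Y p - h\<^sup>2 *\<^sub>R ?A3" for h
  proof -
    have "h\<^sup>2 *\<^sub>R ?DX (X p) = (h\<^sup>2 / 2) *\<^sub>R ?DX (X p) + (h\<^sup>2 / 2) *\<^sub>R ?DX (X p)"
      by (simp flip: scaleR_left_distrib)
    then show ?thesis
      by (simp add: algebra_simps power2_eq_square linear_add[OF linX])
  qed
  with small_order_add[OF e2 3] have e3: "small_order 3 (\<lambda>h. q3 h - p - h *\<^sub>R Y p - h\<^sup>2 *\<^sub>R ?A3)"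
    by (simp only:)
  obtain q4 where q4: "\<forall>\<^sub>F h in at_right 0. q4 h \<in> F" and
    4: "small_order 3 (\<lambda>h. q4 h - q3 h - (-1 * h) *\<^sub>R (Y p + h *\<^sub>R ?DY (Y p)) - (h\<^sup>2 / 2) *\<^sub>R ?DY (Y p))"
    by (rule stepY[OF q3 lower[OF e3], where c="-1"]) auto
  have "(q3 h - p - h *\<^sub>R Y p - h\<^sup>2 *\<^sub>R ?A3) +
      (q4 h - q3 h - (-1 * h) *\<^sub>R (Y p + h *\<^sub>R ?DY (Y p)) - (h\<^sup>2 / 2) *\<^sub>R ?DY (Y p))
      = q4 h - p - h\<^sup>2 *\<^sub>R ?Z" for h
  proof -
    have "h\<^sup>2 *\<^sub>R ?DY (Y p) = (h\<^sup>2 / 2) *\<^sub>R ?DY (Y p) + (h\<^sup>2 / 2) *\<^sub>R ?DY (Y p)"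
      by (simp flip: scaleR_left_distrib)
    then show ?thesis by (simp add: algebra_simps power2_eq_square)
  qed
  with small_order_add[OF e3 4] have e4: "small_order 3 (\<lambda>h. q4 h - p - h\<^sup>2 *\<^sub>R ?Z)"
    by (simp only:)
  \<comment> \<open>As q4 h lies outside the ball, comparing squared distances to z gives 2 h^2
    \<open>?Z\<close> . (z - p) \<le> \<open>?g h\<close>. The displacement q4 h - p is O(h^2), so
    its square is O(h^4) and \<open>?g\<close> is O(h^3); dividing by h^2 and letting h tend to 0
    concludes.\<close>
  let ?g = "\<lambda>h. (norm (q4 h - p))\<^sup>2 - 2 * ((q4 h - p - h\<^sup>2 *\<^sub>R ?Z) \<bullet> (z - p))"
  have "small_order 4 (\<lambda>h. (norm (q4 h - p))\<^sup>2)"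
    using small_order_compare[of "\<lambda>h. (norm (q4 h - p))\<^sup>2" 1 "\<lambda>h. q4 h - p" 2 2] lower[OF e4] by simp
  then have s1: "small_order 3 (\<lambda>h. (norm (q4 h - p))\<^sup>2)" by (rule small_order_mono) simp
  have s2: "small_order 3 (\<lambda>h. 2 * ((q4 h - p - h\<^sup>2 *\<^sub>R ?Z) \<bullet> (z - p)))"
  proof (rule small_order_bound[OF e4, of "2 * norm (z - p)"])
    show "norm (2 * ((q4 h - p - h\<^sup>2 *\<^sub>R ?Z) \<bullet> (z - p))) \<le> 2 * norm (z - p) * norm (q4 h - p - h\<^sup>2 *\<^sub>R ?Z)" for h
      using Cauchy_Schwarz_ineq2[of "q4 h - p - h\<^sup>2 *\<^sub>R ?Z" "z - p"] by (simp add: abs_mult mult.commute)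
  qed simp
  obtain K where K: "\<forall>\<^sub>F h in at_right 0. norm (?g h) \<le> K * h ^ 3"
    using small_order_diff[OF s1 s2] unfolding small_order_def by blast
  from K q4 eventually_at_right_0_less_1 have "\<forall>\<^sub>F h in at_right 0. 2 * (?Z \<bullet> (z - p)) \<le> K * h"
  proof eventually_elim
    case (elim h)
    have "q4 h \<notin> ball z (dist z p)" using z elim by blast
    then have "(dist z p)\<^sup>2 \<le> (dist z (q4 h))\<^sup>2" by (intro power_mono) auto
    moreover have "(dist z (q4 h))\<^sup>2 = (dist z p)\<^sup>2 + (norm (q4 h - p))\<^sup>2 - 2 * ((q4 h - p) \<bullet> (z - p))"
      unfolding dist_norm power2_norm_eq_inner by (simp add: inner_commute algebra_simps)
    moreover have "(q4 h - p - h\<^sup>2 *\<^sub>R ?Z) \<bullet> (z - p) = (q4 h - p) \<bullet> (z - p) - h\<^sup>2 * (?Z \<bullet> (z - p))"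
      by (subst inner_diff_left) (simp only: inner_scaleR_left)
    ultimately have "2 * (h\<^sup>2 * (?Z \<bullet> (z - p))) \<le> ?g h"
      by linarith
    also have "\<dots> \<le> h\<^sup>2 * (K * h)"
      using elim by (simp add: power3_eq_cube power2_eq_square mult_ac)
    finally have "h\<^sup>2 * (2 * (?Z \<bullet> (z - p))) \<le> h\<^sup>2 * (K * h)"
      by (subst mult.left_commute)
    then show ?case by (rule mult_left_le_imp_le) (use elim in simp)
  qed
  moreover have "((\<lambda>h. K * h) \<longlongrightarrow> K * 0) (at_right 0)" by (intro tendsto_intros)
  ultimately have "2 * (?Z \<bullet> (z - p)) \<le> K * 0"
    by (intro tendsto_lowerbound[of "\<lambda>h. K * h" "K * 0" "at_right 0"]) (auto simp: trivial_limit_at_right_real)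
  then show ?thesis by simp
qed

lemma lie_bracket_eq:
  assumes "smooth X" "smooth Y"
  shows "lie_bracket X Y = (\<lambda>x. frechet_derivative Y (at x) (X x) - frechet_derivative X (at x) (Y x))"
proof
  fix x
  show "lie_bracket X Y x = frechet_derivative Y (at x) (X x) - frechet_derivative X (at x) (Y x)"
    using has_derivative_linear[OF smooth_has_derivative[OF assms(1)]]
      has_derivative_linear[OF smooth_has_derivative[OF assms(2)]]
    by (simp add: lie_bracket_def jacobian_def matrix_works)
qed

lemma smooth_lie_bracket:
  assumes "smooth X" "smooth Y" shows "smooth (lie_bracket X Y)"
proof -
  have "C_k k (\<lambda>x. frechet_derivative Y (at x) (X x) + - frechet_derivative X (at x) (Y x))" for k
    using smooth_C_k[OF smooth_directional_derivative] assms by (intro C_k_add C_k_uminus)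
  then show ?thesis unfolding lie_bracket_eq[OF assms] smooth_def by simp
qed

text \<open>The one-sided inequality for the commutator, applied to (X, Y) and to (Y, X), gives both
  signs.\<close>

lemma tangent_to_lie_bracket:
  assumes "smooth X" "tangent_to X F U" "smooth Y" "tangent_to Y F U" "closed F" "open U"
  shows "tangent_to (lie_bracket X Y) F U"
  unfolding tangent_to_def
proof (intro ballI allI impI)
  fix p z assume pz: "p \<in> F \<inter> U" "ball z (dist z p) \<inter> F = {}"
  show "lie_bracket X Y p \<bullet> (z - p) = 0"
    using tangent_commutator_le[OF assms pz] tangent_commutator_le[OF assms(3,4,1,2,5,6) pz]
    by (simp add: lie_bracket_eq[OF assms(1,3)] inner_diff_left)
qed

text \<open>If a point y near p were outside \<open>F\<close>, then y - q for its nearest point q in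
  \<open>F\<close> would be a nonzero vector orthogonal to all iterated commutators at q, which span
  the space.\<close>

theorem hoermander_tangent_open:
  assumes H: "hoermander_condition X" and smooth: "\<And>j. smooth (X j)"
    and tan: "\<And>j. tangent_to (X j) F U" and F: "closed F" and U: "open U"
  shows "open (F \<inter> U)"
proof -
  have comm: "smooth Y \<and> tangent_to Y F U" if "Y \<in> iterated_commutators X" for Y
    using that
  proof induction
    case (field j)
    then show ?case using smooth tan by blast
  next
    case (bracket Y Z)
    then show ?case using smooth_lie_bracket tangent_to_lie_bracket[OF _ _ _ _ F U] by blast
  qed
  show ?thesis unfolding open_contains_ball
  proof
    fix p assume p: "p \<in> F \<inter> U"
    then obtain r where r: "0 < r" "ball p r \<subseteq> U" using U open_contains_ball by blast
    \<comment> \<open>Half the radius keeps the nearest point in \<open>U\<close>, because it is no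
      farther from y than p is.\<close>
    have "y \<in> F" if y: "y \<in> ball p (r / 2)" for y
    proof (rule ccontr)
      assume "y \<notin> F"
      obtain q where q: "q \<in> F" "infdist y F = dist y q"
        using infdist_attains_inf[OF F] p by blast
      have "dist y q \<le> dist y p" using q infdist_le[of p F y] p by simp
      then have "q \<in> U"
        using y r dist_triangle[of p q y] by (auto simp: dist_commute)
      have ball: "ball y (dist y q) \<inter> F = {}" using q(2) infdist_le[of _ F y] by fastforce
      have "orthogonal (y - q) (y - q)"
      proof (rule orthogonal_to_span)
        show "y - q \<in> span {Y q |Y. Y \<in> iterated_commutators X}"
          using H by (simp add: hoermander_condition_def)
        show "orthogonal (y - q) v" if "v \<in> {Y q |Y. Y \<in> iterated_commutators X}" for v
          using that comm ball \<open>q \<in> F\<close> \<open>q \<in> U\<close>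
          by (auto simp: tangent_to_def orthogonal_def inner_commute)
      qed
      then show False using \<open>y \<notin> F\<close> q by (simp add: orthogonal_def)
    qed
    then show "\<exists>e>0. ball p e \<subseteq> F \<inter> U"
      using r by (intro exI[of _ "r / 2"]) auto
  qed
qed

section \<open>Upper semicontinuous functions\<close>

lemma usc_open:
  assumes "usc V" shows "open {x. V x < a}"
proof (subst open_subopen, intro ballI)
  fix x assume "x \<in> {x. V x < a}"
  then have "\<forall>\<^sub>F y in nhds x. V y < a" using assms unfolding usc_def by simp
  then obtain S where "open S" "x \<in> S" "\<forall>y\<in>S. V y < a" unfolding eventually_nhds by blast
  then show "\<exists>T. open T \<and> x \<in> T \<and> T \<subseteq> {x. V x < a}" by (intro exI[of _ S]) auto
qed

text \<open>Without a maximum, the open sets {V < V y} with y in \<open>K\<close> cover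
  \<open>K\<close>; in a finite subcover, the centre with the largest value is not covered.\<close>

lemma usc_attains_max:
  assumes "usc V" "compact K" "K \<noteq> {}"
  obtains x where "x \<in> K" "\<And>y. y \<in> K \<Longrightarrow> V y \<le> V x"
proof -
  have "\<exists>x\<in>K. \<forall>y\<in>K. V y \<le> V x"
  proof (rule ccontr)
    assume "\<not> ?thesis"
    then have "K \<subseteq> (\<Union>y\<in>K. {x. V x < V y})" by (auto simp: not_le)
    then obtain C where C: "C \<subseteq> K" "finite C" "K \<subseteq> (\<Union>y\<in>C. {x. V x < V y})"
      by (rule compactE_image[OF assms(2), rotated]) (auto intro: usc_open[OF assms(1)])
    then have "C \<noteq> {}" using assms(3) by auto
    then have "Max (V ` C) \<in> V ` C" using C(2) by (intro Max_in) auto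
    then obtain y where y: "y \<in> C" "V y = Max (V ` C)" by (metis imageE)
    obtain y' where "y' \<in> C" "V y < V y'" using C y(1) by auto
    moreover have "V y' \<le> Max (V ` C)" using C(2) \<open>y' \<in> C\<close> by (intro Max_ge) auto
    ultimately show False using y(2) by simp
  qed
  then show ?thesis using that by blast
qed

lemma usc_add_continuous:
  fixes V f :: "'a::euclidean_space \<Rightarrow> real"
  assumes "usc V" "continuous_on UNIV f" shows "usc (\<lambda>x. V x + f x)"
  unfolding usc_def
proof (intro allI impI)
  fix x a assume "V x + f x < a"
  then have V: "V x < V x + (a - V x - f x) / 2" and f: "f x < f x + (a - V x - f x) / 2" by simp_all
  have "isCont f x"
    using continuous_on_eq_continuous_at[THEN iffD1, OF open_UNIV assms(2)] by blast
  then have "(f \<longlongrightarrow> f x) (nhds x)"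
    using isCont_def[of x f] tendsto_at_iff_tendsto_nhds[of f x] by (simp only:)
  then have "\<forall>\<^sub>F y in nhds x. f y < f x + (a - V x - f x) / 2"
    using f by (rule order_tendstoD)
  moreover have "\<forall>\<^sub>F y in nhds x. V y < V x + (a - V x - f x) / 2"
    using assms(1) V unfolding usc_def by blast
  ultimately show "\<forall>\<^sub>F y in nhds x. V y + f y < a"
    by eventually_elim (simp add: field_simps)
qed

section \<open>The operator L\<close>

text \<open>Writes the second-order part as a sum of quadratic forms in the columns, so that the
  individual vector fields become visible.\<close>

lemma trace_mult_transpose:
  fixes A :: "real^'m^'n"
  shows "trace (A ** transpose A ** H) = (\<Sum>j\<in>UNIV. column j A \<bullet> (H *v column j A))"
proof -
  have "trace (A ** transpose A ** H) = (\<Sum>i\<in>UNIV. \<Sum>k\<in>UNIV. \<Sum>j\<in>UNIV. A$i$j * A$k$j * H$k$i)"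
    by (simp add: trace_def matrix_matrix_mult_def transpose_def sum_distrib_right)
  also have "\<dots> = (\<Sum>i\<in>UNIV. \<Sum>j\<in>UNIV. \<Sum>k\<in>UNIV. A$i$j * A$k$j * H$k$i)"
    by (intro sum.cong refl sum.swap)
  also have "\<dots> = (\<Sum>j\<in>UNIV. \<Sum>i\<in>UNIV. \<Sum>k\<in>UNIV. A$i$j * A$k$j * H$k$i)"
    by (rule sum.swap)
  also have "\<dots> = (\<Sum>j\<in>UNIV. \<Sum>k\<in>UNIV. \<Sum>i\<in>UNIV. A$i$j * A$k$j * H$k$i)"
    by (intro sum.cong refl sum.swap)
  also have "\<dots> = (\<Sum>j\<in>UNIV. column j A \<bullet> (H *v column j A))"
    by (simp add: inner_vec_def matrix_vector_mult_def column_def sum_distrib_left mult_ac)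
  finally show ?thesis .
qed

lemma grad_eq:
  assumes "(f has_derivative f') (at x)" shows "grad f x = (\<chi> i. f' (axis i 1))"
  using frechet_derivative_at[OF assms] by (simp add: grad_def)

lemma grad_has_derivative:
  fixes f :: "real^'n \<Rightarrow> real"
  assumes "C_k 2 f"
  shows "(grad f has_derivative frechet_derivative (grad f) (at x)) (at x)"
proof -
  have "grad f = (\<lambda>x. \<Sum>i\<in>UNIV. frechet_derivative f (at x) (axis i 1) *\<^sub>R axis i 1)"
  proof
    fix x
    show "grad f x = (\<Sum>i\<in>UNIV. frechet_derivative f (at x) (axis i 1) *\<^sub>R axis i 1)"
      by (simp add: grad_def vec_eq_iff axis_def if_distrib[of "(*) _"] cong: if_cong)
  qed
  moreover have "C_k (Suc 0) (\<lambda>x. \<Sum>i\<in>UNIV. frechet_derivative f (at x) (axis i 1) *\<^sub>R axis i 1 :: real^'n)"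
    using assms unfolding numeral_2_eq_2 C_k.simps(2)[of "Suc 0"]
    by (intro C_k_sum C_k_bounded_linear[OF bounded_linear_scaleR_left]) (auto simp: axis_in_Basis_iff simp del: C_k.simps)
  ultimately have "C_k (Suc 0) (grad f)" by simp
  then show ?thesis by (rule C_k_has_derivative)
qed

lemma L_op_eq:
  assumes "(grad f has_derivative G) (at x)"
  shows "L_op \<sigma> b f x = - (\<Sum>j\<in>UNIV. column j (\<sigma> x) \<bullet> G (column j (\<sigma> x))) - b x \<bullet> grad f x"
proof -
  have "hess f x *v v = G v" for v
    using frechet_derivative_at[OF assms] has_derivative_linear[OF assms]
    by (simp add: hess_def jacobian_def matrix_works)
  then show ?thesis by (simp add: L_op_def trace_mult_transpose)
qed

lemma L_op_linear:
  assumes "C_k 2 f" "C_k 2 g"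
  shows "L_op \<sigma> b (\<lambda>x. a * f x + c * g x) x = a * L_op \<sigma> b f x + c * L_op \<sigma> b g x"
proof -
  have D: "(f has_derivative frechet_derivative f (at x)) (at x)"
      "(g has_derivative frechet_derivative g (at x)) (at x)" for x
    using C_k_has_derivative[of "Suc 0"] assms by (simp_all add: numeral_2_eq_2)
  have gr: "grad (\<lambda>x. a * f x + c * g x) = (\<lambda>x. a *\<^sub>R grad f x + c *\<^sub>R grad g x)"
  proof
    fix x
    have "((\<lambda>x. a * f x + c * g x) has_derivative
        (\<lambda>h. a * frechet_derivative f (at x) h + c * frechet_derivative g (at x) h)) (at x)"
      by (intro has_derivative_add has_derivative_mult_right D)
    from grad_eq[OF this] show "grad (\<lambda>x. a * f x + c * g x) x = a *\<^sub>R grad f x + c *\<^sub>R grad g x"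
      by (simp add: grad_def vec_eq_iff)
  qed
  have "(grad (\<lambda>x. a * f x + c * g x) has_derivative
      (\<lambda>h. a *\<^sub>R frechet_derivative (grad f) (at x) h + c *\<^sub>R frechet_derivative (grad g) (at x) h)) (at x)"
    unfolding gr by (intro has_derivative_add has_derivative_scaleR_right grad_has_derivative assms)
  from L_op_eq[OF this] show ?thesis
    unfolding L_op_eq[OF grad_has_derivative[OF assms(1)]] L_op_eq[OF grad_has_derivative[OF assms(2)]] gr
    by (simp add: inner_add_right sum.distrib sum_distrib_left[symmetric] algebra_simps)
qed

lemma L_op_uminus: "C_k 2 f \<Longrightarrow> L_op \<sigma> b (\<lambda>x. - f x) x = - L_op \<sigma> b f x"
  using L_op_linear[of f f \<sigma> b "-1" 0 x] by simp

section \<open>The Gaussian barrier of Hopf's argument\<close>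

definition gauss_barrier :: "real \<Rightarrow> 'a::euclidean_space \<Rightarrow> 'a \<Rightarrow> real" where
  "gauss_barrier \<alpha> z x = exp (- \<alpha> * (norm (x - z))\<^sup>2)"

lemma gauss_barrier_has_derivative:
  "(gauss_barrier \<alpha> z has_derivative (\<lambda>h. - 2 * \<alpha> * gauss_barrier \<alpha> z x * ((x - z) \<bullet> h))) (at x)"
  unfolding gauss_barrier_def[abs_def] power2_norm_eq_inner
  by (auto intro!: derivative_eq_intros simp: inner_commute algebra_simps)

lemma C_k_gauss_barrier: "C_k k (gauss_barrier \<alpha> z)"
proof (induction k)
  case 0
  show ?case unfolding gauss_barrier_def[abs_def] by (auto intro!: continuous_intros)
next
  case (Suc k)
  show ?case
  proof (rule C_k_SucI[OF gauss_barrier_has_derivative])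
    fix e :: 'a
    have "C_k k (\<lambda>x. gauss_barrier \<alpha> z x *\<^sub>R (- 2 * \<alpha> * ((x + - z) \<bullet> e)))"
      by (intro C_k_scaleR Suc C_k_bounded_linear[OF bounded_linear_mult_right]
          C_k_bounded_linear[OF bounded_linear_inner_left] C_k_add C_k_id C_k_const)
    then show "C_k k (\<lambda>x. - 2 * \<alpha> * gauss_barrier \<alpha> z x * ((x - z) \<bullet> e))"
      by (simp add: mult_ac)
  qed
qed

text \<open>Inside the last factor \<alpha> multiplies only the sum of squares. Where some column is
  not orthogonal to x - z, a large \<alpha> therefore makes the barrier a strict
  subsolution.\<close>

lemma L_op_gauss_barrier:
  "L_op \<sigma> b (gauss_barrier \<alpha> z) x = - gauss_barrier \<alpha> z x * (2 * \<alpha>) *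
     (2 * \<alpha> * (\<Sum>j\<in>UNIV. (column j (\<sigma> x) \<bullet> (x - z))\<^sup>2)
      - ((\<Sum>j\<in>UNIV. column j (\<sigma> x) \<bullet> column j (\<sigma> x)) + b x \<bullet> (x - z)))"
proof -
  let ?\<psi> = "gauss_barrier \<alpha> z"
  have gr: "grad ?\<psi> = (\<lambda>x. (- 2 * \<alpha> * ?\<psi> x) *\<^sub>R (x - z))"
    by (rule ext) (simp add: grad_eq[OF gauss_barrier_has_derivative] vec_eq_iff inner_axis)
  have "(grad ?\<psi> has_derivative (\<lambda>h. (- 2 * \<alpha> * ?\<psi> x) *\<^sub>R h
      + (- 2 * \<alpha> * (- 2 * \<alpha> * ?\<psi> x * ((x - z) \<bullet> h))) *\<^sub>R (x - z))) (at x)"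
    unfolding gr
    by (auto intro!: derivative_eq_intros gauss_barrier_has_derivative)
  from L_op_eq[OF this, of \<sigma> b] show ?thesis
    unfolding gr
    by (simp add: inner_add_right sum.distrib sum_distrib_left sum_negf sum_subtractf power2_eq_square inner_commute algebra_simps)
qed

section \<open>The strong maximum principle\<close>

text \<open>Localised so that one maximum principle serves both the exterior of the ball, where w is
  a supersolution, and the whole space.\<close>

definition viscosity_subsolution_on ::
    "(real^'n) set \<Rightarrow> (real^'n \<Rightarrow> real^'m^'n) \<Rightarrow> (real^'n \<Rightarrow> real^'n) \<Rightarrow> (real^'n \<Rightarrow> real) \<Rightarrow> bool" where
  "viscosity_subsolution_on U \<sigma> b V \<longleftrightarrow>
     (\<forall>\<phi>. \<forall>x\<in>U. C_k 2 \<phi> \<longrightarrow> (\<forall>\<^sub>F y in nhds x. V y - \<phi> y \<le> V x - \<phi> x) \<longrightarrow> L_op \<sigma> b \<phi> x \<le> 0)"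

text \<open>The ball with diameter from p to z touches the larger ball about z from inside, only at
  p. With u and e the vectors from the midpoint to x and z, u + e = x - p, and the parallelogram
  identity makes the inequality strict when this is nonzero.\<close>

lemma midpoint_ball_strict:
  fixes p z x :: "'a::real_inner"
  assumes "dist x (midpoint p z) \<le> dist p (midpoint p z)" "x \<noteq> p"
  shows "dist z x < dist z p"
proof -
  let ?u = "x - midpoint p z" and ?e = "z - midpoint p z"
  have e: "p - midpoint p z = - ?e"
    by (simp add: midpoint_def algebra_simps flip: scaleR_2)
  have "?u + ?e \<noteq> 0" using assms(2) e by (metis add_diff_cancel_right' add_uminus_conv_diff eq_iff_diff_eq_0 add.commute diff_minus_eq_add diff_add_cancel)
  then have 1: "0 < (norm (?u + ?e))\<^sup>2" by simp
  have 2: "(norm ?u)\<^sup>2 \<le> (norm ?e)\<^sup>2"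
    using assms(1) unfolding dist_norm e norm_minus_cancel by (rule power_mono) simp
  have "(dist z x)\<^sup>2 = (norm (?e - ?u))\<^sup>2" by (simp add: dist_norm)
  also have "\<dots> = 2 * (norm ?u)\<^sup>2 + 2 * (norm ?e)\<^sup>2 - (norm (?u + ?e))\<^sup>2"
    unfolding power2_norm_eq_inner inner_add_left inner_add_right inner_diff_left inner_diff_right
    by (simp add: inner_commute)
  also have "\<dots> < 4 * (norm ?e)\<^sup>2" using 1 2 by linarith
  also have "\<dots> = (2 * norm ?e)\<^sup>2" by (simp add: power_mult_distrib)
  also have "2 * norm ?e = dist z p"
  proof -
    have "z - p = 2 *\<^sub>R ?e" by (simp add: midpoint_def algebra_simps scaleR_2)
    then show ?thesis by (simp add: dist_norm)
  qed
  finally show ?thesis by (rule power_less_imp_less_base) simp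
qed

text \<open>Hopf's boundary argument: a column not orthogonal to an exterior normal would give a
  barrier contradicting the subsolution property. The complement of \<open>U\<close> is included in
  the set so that a ball missing the set lies in \<open>U\<close>, where V < M.\<close>

lemma maximum_set_tangent:
  fixes \<sigma> :: "real^'n \<Rightarrow> real^'m^'n" and b :: "real^'n \<Rightarrow> real^'n"
  assumes \<sigma>: "continuous_on UNIV \<sigma>" and b: "continuous_on UNIV b" and U: "open U"
    and V: "usc V" and sub: "viscosity_subsolution_on U \<sigma> b V" and M: "\<And>x. x \<in> U \<Longrightarrow> V x \<le> M"
  shows "tangent_to (\<lambda>x. column j (\<sigma> x)) {x. x \<in> U \<longrightarrow> V x = M} U"
  unfolding tangent_to_def
proof (intro ballI allI impI, rule ccontr)
  fix p z0
  assume p: "p \<in> {x. x \<in> U \<longrightarrow> V x = M} \<inter> U"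
    and ball: "ball z0 (dist z0 p) \<inter> {x. x \<in> U \<longrightarrow> V x = M} = {}"
    and nz: "column j (\<sigma> p) \<bullet> (z0 - p) \<noteq> 0"
  \<comment> \<open>The ball around \<open>z\<close> of half the radius touches the maximum set only at \<open>p\<close>.\<close>
  define z where "z = midpoint p z0"
  have below: "x \<in> U \<and> V x < M" if "dist x z \<le> dist p z" "x \<noteq> p" for x
  proof -
    have "x \<in> ball z0 (dist z0 p)" using midpoint_ball_strict that unfolding z_def by simp
    then have "x \<in> U" "V x \<noteq> M" using ball by auto
    then show ?thesis using M[of x] by simp
  qed
  have col: "continuous_on UNIV (\<lambda>x. column i (\<sigma> x))" for i
    unfolding column_def by (intro continuous_intros \<sigma>)
  define Q where "Q x = (\<Sum>i\<in>UNIV. (column i (\<sigma> x) \<bullet> (x - z))\<^sup>2)" for x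
  define T where "T x = (\<Sum>i\<in>UNIV. column i (\<sigma> x) \<bullet> column i (\<sigma> x)) + b x \<bullet> (x - z)" for x
  have Qc: "continuous_on UNIV Q" and Tc: "continuous_on UNIV T"
    unfolding Q_def T_def by (intro continuous_intros col b)+
  have "p - z = (1/2) *\<^sub>R (p - z0)"
    by (simp add: z_def midpoint_def vec_eq_iff field_simps)
  then have "column j (\<sigma> p) \<bullet> (p - z) \<noteq> 0" using nz by (simp add: inner_diff_right)
  then have "0 < (column j (\<sigma> p) \<bullet> (p - z))\<^sup>2" by simp
  also have "\<dots> \<le> Q p" unfolding Q_def by (rule member_le_sum) auto
  finally have Qp: "0 < Q p" .
  then have "open {x. Q p / 2 < Q x}"
    by (intro open_Collect_less continuous_intros Qc)
  then have "open ({x. Q p / 2 < Q x} \<inter> U)" using U by blast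
  moreover have "p \<in> {x. Q p / 2 < Q x} \<inter> U" using p Qp by simp
  ultimately obtain \<rho> where \<rho>: "0 < \<rho>" "cball p \<rho> \<subseteq> {x. Q p / 2 < Q x} \<inter> U"
    using open_contains_cball by metis
  obtain B where B: "0 \<le> B" "\<And>x. x \<in> cball p \<rho> \<Longrightarrow> norm (T x) \<le> B"
    using continuous_bounded_cball[OF Tc] by blast
  \<comment> \<open>Since Q > Q p / 2 on the small ball, 2 \<alpha> Q exceeds B + 1 there and
    dominates the lower-order part \<open>T\<close>.\<close>
  define \<alpha> where "\<alpha> = (B + 1) / Q p"
  have \<alpha>: "0 < \<alpha>" using B Qp by (simp add: \<alpha>_def)
  let ?\<psi> = "gauss_barrier \<alpha> z"
  have L\<psi>: "L_op \<sigma> b ?\<psi> x < 0" if x: "x \<in> cball p \<rho>" for x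
  proof -
    have "B + 1 = 2 * \<alpha> * (Q p / 2)" using Qp by (simp add: \<alpha>_def)
    also have "\<dots> \<le> 2 * \<alpha> * Q x" using \<rho>(2) x \<alpha> by (intro mult_left_mono) auto
    finally have "0 < 2 * \<alpha> * Q x - T x" using B(2)[OF x] by auto
    moreover have "0 < ?\<psi> x * (2 * \<alpha>)" using \<alpha> by (simp add: gauss_barrier_def)
    ultimately have "0 < ?\<psi> x * (2 * \<alpha>) * (2 * \<alpha> * Q x - T x)" by (rule mult_pos_pos[rotated])
    then show ?thesis unfolding L_op_gauss_barrier Q_def T_def by simp
  qed
  \<comment> \<open>On this compact part of the small sphere V < M by \<open>below\<close>, and
    upper semicontinuity makes the gap uniform.\<close>
  obtain \<delta> where \<delta>: "0 < \<delta>" "\<And>x. x \<in> sphere p \<rho> \<inter> cball z (dist p z) \<Longrightarrow> V x \<le> M - \<delta>"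
  proof (cases "sphere p \<rho> \<inter> cball z (dist p z) = {}")
    case True
    show ?thesis by (rule that[of 1]) (use True in auto)
  next
    case False
    moreover have "compact (sphere p \<rho> \<inter> cball z (dist p z))" by (simp add: compact_Int)
    ultimately obtain x where x: "x \<in> sphere p \<rho> \<inter> cball z (dist p z)"
      "\<And>y. y \<in> sphere p \<rho> \<inter> cball z (dist p z) \<Longrightarrow> V y \<le> V x"
      using usc_attains_max[OF V] by metis
    have "V x < M" using below[of x] x(1) \<rho>(1) by (auto simp: dist_commute)
    then show ?thesis using that[of "M - V x"] x(2) by auto
  qed
  \<comment> \<open>The barrier is at most 1, so the perturbation cannot fill the gap \<delta>;
    outside the ball about \<open>z\<close> the barrier is smaller than at \<open>p\<close>. Hence
    the perturbed maximum is not on the small sphere.\<close>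
  define \<epsilon> where "\<epsilon> = \<delta> / 2"
  have \<epsilon>: "0 < \<epsilon>" using \<delta> by (simp add: \<epsilon>_def)
  have g: "usc (\<lambda>x. V x + \<epsilon> * ?\<psi> x)"
    by (intro usc_add_continuous V continuous_intros C_k_continuous[OF C_k_gauss_barrier])
  have ne: "cball p \<rho> \<noteq> {}" using \<rho> by auto
  obtain x1 where x1: "x1 \<in> cball p \<rho>"
    "\<And>y. y \<in> cball p \<rho> \<Longrightarrow> V y + \<epsilon> * ?\<psi> y \<le> V x1 + \<epsilon> * ?\<psi> x1"
    by (rule usc_attains_max[OF g compact_cball ne]) (rule that)
  have Vp: "V p = M" using p by simp
  have "x1 \<notin> sphere p \<rho>"
  proof
    assume s: "x1 \<in> sphere p \<rho>"
    have "V x1 + \<epsilon> * ?\<psi> x1 < M + \<epsilon> * ?\<psi> p"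
    proof (cases "x1 \<in> cball z (dist p z)")
      case True
      have "?\<psi> x1 \<le> 1" using \<alpha> by (simp add: gauss_barrier_def)
      then have "\<epsilon> * ?\<psi> x1 \<le> \<epsilon>" using \<epsilon> by simp
      moreover have "V x1 \<le> M - \<delta>" using \<delta>(2) s True by blast
      moreover have "0 < \<epsilon> * ?\<psi> p" using \<epsilon> by (simp add: gauss_barrier_def)
      ultimately show ?thesis using \<delta>(1) unfolding \<epsilon>_def by linarith
    next
      case False
      then have "(norm (p - z))\<^sup>2 < (norm (x1 - z))\<^sup>2"
        by (intro power_strict_mono) (auto simp: dist_norm norm_minus_commute)
      then have "?\<psi> x1 < ?\<psi> p" using \<alpha> by (simp add: gauss_barrier_def)
      moreover have "V x1 \<le> M" using M x1(1) \<rho>(2) by blast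
      ultimately show ?thesis using \<epsilon> by (simp add: add_le_less_mono)
    qed
    moreover have "V p + \<epsilon> * ?\<psi> p \<le> V x1 + \<epsilon> * ?\<psi> x1" using x1(2)[of p] \<rho>(1) by simp
    ultimately show False using Vp by simp
  qed
  then have "x1 \<in> ball p \<rho>" using x1(1) by auto
  then have "\<forall>\<^sub>F y in nhds x1. y \<in> ball p \<rho>" by (intro eventually_nhds_in_open) auto
  \<comment> \<open>The function - \<epsilon> \<open>?\<psi>\<close>, up to a constant, touches V
    from above at \<open>x1\<close>, but L of it is positive there.\<close>
  then have "\<forall>\<^sub>F y in nhds x1. V y - - \<epsilon> * ?\<psi> y \<le> V x1 - - \<epsilon> * ?\<psi> x1"
    by eventually_elim (use x1(2) in auto)
  moreover have "C_k 2 (\<lambda>x. - \<epsilon> * ?\<psi> x)"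
    by (rule C_k_bounded_linear[OF bounded_linear_mult_right C_k_gauss_barrier])
  moreover have "x1 \<in> U" using x1(1) \<rho>(2) by blast
  ultimately have "L_op \<sigma> b (\<lambda>x. - \<epsilon> * ?\<psi> x) x1 \<le> 0"
    using sub unfolding viscosity_subsolution_on_def by blast
  moreover have "L_op \<sigma> b (\<lambda>x. - \<epsilon> * ?\<psi> x) x1 = - \<epsilon> * L_op \<sigma> b ?\<psi> x1"
    using L_op_linear[OF C_k_gauss_barrier C_k_gauss_barrier, of \<sigma> b "- \<epsilon>" \<alpha> z 0 \<alpha> z x1] by simp
  ultimately show False using L\<psi>[OF x1(1)] \<epsilon> by (simp add: zero_le_mult_iff)
qed

text \<open>Adding the complement of \<open>U\<close> to the maximum set gives a set closed in the
  whole space, as nearest points require; intersecting with \<open>U\<close> afterwards removes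
  it.\<close>

theorem strong_maximum_principle:
  fixes \<sigma> :: "real^'n \<Rightarrow> real^'m^'n" and b :: "real^'n \<Rightarrow> real^'n"
  assumes \<sigma>: "smooth \<sigma>" and b: "smooth b" and H: "hoermander_condition (\<lambda>j x. column j (\<sigma> x))"
    and U: "open U" and V: "usc V" and sub: "viscosity_subsolution_on U \<sigma> b V"
    and M: "\<And>x. x \<in> U \<Longrightarrow> V x \<le> M"
  shows "open {x \<in> U. V x = M}"
proof -
  let ?F = "{x. x \<in> U \<longrightarrow> V x = M}"
  have 1: "smooth (\<lambda>x. column j (\<sigma> x))" for j
  proof -
    have "linear (\<lambda>A::real^'m^'n. column j A)"
      by (rule linearI) (simp_all add: column_def vec_eq_iff)
    then show ?thesis using smooth_bounded_linear[OF linear_conv_bounded_linear[THEN iffD1] \<sigma>] by blast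
  qed
  have 2: "tangent_to (\<lambda>x. column j (\<sigma> x)) ?F U" for j
    by (rule maximum_set_tangent[OF C_k_continuous[OF smooth_C_k[OF \<sigma>]]
        C_k_continuous[OF smooth_C_k[OF b]] U V sub M])
  have 3: "closed ?F"
  proof -
    have "- ?F = U \<inter> {x. V x < M}" using M by (auto simp: less_le)
    then show ?thesis unfolding closed_def using U usc_open[OF V] by (simp add: open_Int)
  qed
  have "open (?F \<inter> U)" by (rule hoermander_tangent_open[OF H 1 2 3 U])
  moreover have "?F \<inter> U = {x \<in> U. V x = M}" by blast
  ultimately show ?thesis by simp
qed

section \<open>The Liouville property\<close>

text \<open>Used below for V - \<zeta> w, whose decay at infinity is the assumption
  \<open>coercive\<close>.\<close>

lemma exterior_maximum_on_sphere:
  fixes \<sigma> :: "real^'n \<Rightarrow> real^'m^'n" and b :: "real^'n \<Rightarrow> real^'n"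
  assumes \<sigma>: "smooth \<sigma>" and b: "smooth b" and H: "hoermander_condition (\<lambda>j x. column j (\<sigma> x))"
    and V: "usc V" and sub: "viscosity_subsolution_on (- cball 0 R) \<sigma> b V"
    and R: "0 < R" and coercive: "\<And>c. \<forall>\<^sub>F x in at_infinity. V x < c" and x: "R \<le> norm x"
  obtains y where "norm y = R" "V x \<le> V y"
proof -
  \<comment> \<open>Beyond radius c the values are below V x, so a maximum over the compact annulus
    is one over the whole exterior.\<close>
  obtain c where c: "\<And>y. c \<le> norm y \<Longrightarrow> V y < V x"
    using coercive[of "V x"] unfolding eventually_at_infinity by blast
  have "compact (cball 0 c - ball 0 R :: (real^'n) set)" by (simp add: compact_diff)
  moreover have "x \<in> cball 0 c - ball 0 R" using x c[of x] by force
  ultimately obtain m where m: "m \<in> cball 0 c - ball 0 R" "\<And>y. y \<in> cball 0 c - ball 0 R \<Longrightarrow> V y \<le> V m"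
    using usc_attains_max[OF V] by (metis empty_iff)
  have xm: "V x \<le> V m" using m(2) \<open>x \<in> cball 0 c - ball 0 R\<close> by blast
  have max: "V y \<le> V m" if "R \<le> norm y" for y
    using m(2)[of y] c[of y] that xm by (cases "c \<le> norm y") auto
  let ?K = "(cball 0 c - ball 0 R) - {y. V y < V m}"
  have "compact ?K" using usc_open[OF V] by (simp add: compact_diff)
  moreover have "m \<in> ?K" using m by simp
  moreover have "continuous_on ?K norm" by (intro continuous_intros)
  ultimately obtain y where y: "y \<in> ?K" "\<And>u. u \<in> ?K \<Longrightarrow> norm y \<le> norm u"
    using continuous_attains_inf[of ?K norm] by (metis empty_iff)
  have "norm y = R"
  proof (rule ccontr)
    assume "norm y \<noteq> R"
    then have yU: "y \<in> - cball 0 R" using y(1) by auto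
    have "open {u \<in> - cball 0 R. V u = V m}"
      by (rule strong_maximum_principle[OF \<sigma> b H _ V sub]) (auto intro: max)
    moreover have "y \<in> {u \<in> - cball 0 R. V u = V m}" using yU y(1) max[of y] by auto
    ultimately obtain e where e: "0 < e" "ball y e \<subseteq> {u \<in> - cball 0 R. V u = V m}"
      using open_contains_ball by metis
    have y0: "0 < norm y" using yU R by auto
    \<comment> \<open>Shrinking y by the factor 1 - t stays in the ball of radius e about y, hence
      in the maximum set, and contradicts the minimality of |y|.\<close>
    define t where "t = min (1/2) (e / (2 * norm y))"
    have t: "0 < t" "t < 1" using e(1) y0 by (auto simp: t_def)
    have "t * norm y \<le> e / (2 * norm y) * norm y" using y0 by (intro mult_right_mono) (auto simp: t_def)
    also have "\<dots> < e" using y0 e(1) by simp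
    finally have "(1 - t) *\<^sub>R y \<in> ball y e" using t by (simp add: dist_norm scaleR_left_diff_distrib)
    then have u: "R < norm ((1 - t) *\<^sub>R y)" "V ((1 - t) *\<^sub>R y) = V m" using e(2) by auto
    have less: "norm ((1 - t) *\<^sub>R y) < norm y" using t y0 by simp
    then have "(1 - t) *\<^sub>R y \<in> ?K" using u y(1) by auto
    then show False using y(2) less by fastforce
  qed
  moreover have "V x \<le> V y" using y(1) xm by auto
  ultimately show ?thesis using that by blast
qed

theorem liouville_subsolution:
  fixes \<sigma> :: "real^'n \<Rightarrow> real^'m^'n" and b :: "real^'n \<Rightarrow> real^'n"
  assumes \<sigma>: "smooth \<sigma>" and b: "smooth b" and H: "hoermander_condition (\<lambda>j x. column j (\<sigma> x))"
    and w: "C_k 2 w" and R: "0 < R" and Lw: "\<And>x. R < norm x \<Longrightarrow> 0 \<le> L_op \<sigma> b w x"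
    and winf: "filterlim w at_top at_infinity"
    and V: "usc V" and sub: "viscosity_subsolution \<sigma> b V"
    and lim: "Limsup at_infinity (\<lambda>x. ereal (V x / w x)) \<le> 0"
  shows "V constant_on UNIV"
proof -
  have wc: "continuous_on UNIV w" using w by (rule C_k_continuous)
  have ext: "\<exists>y. norm y = R \<and> V x - \<zeta> * w x \<le> V y - \<zeta> * w y" if \<zeta>: "0 < \<zeta>" and x: "R \<le> norm x" for \<zeta> x
  proof -
    let ?V = "\<lambda>x. V x + - \<zeta> * w x"
    have 1: "usc ?V" by (intro usc_add_continuous V continuous_intros wc)
    have 2: "viscosity_subsolution_on (- cball 0 R) \<sigma> b ?V"
      unfolding viscosity_subsolution_on_def
    proof (intro allI ballI impI)
      fix \<phi> x assume x: "x \<in> - cball 0 R" and \<phi>: "C_k 2 \<phi>"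
        and loc: "\<forall>\<^sub>F y in nhds x. ?V y - \<phi> y \<le> ?V x - \<phi> x"
      \<comment> \<open>If \<phi> touches V - \<zeta> w from above at x, then \<phi> + \<zeta> w
        touches V there; linearity moves the w term to the other side.\<close>
      from loc have "\<forall>\<^sub>F y in nhds x. V y - (1 * \<phi> y + \<zeta> * w y) \<le> V x - (1 * \<phi> x + \<zeta> * w x)"
        by eventually_elim simp
      moreover have "C_k 2 (\<lambda>x. 1 * \<phi> x + \<zeta> * w x)"
        using \<phi> w by (intro C_k_add C_k_bounded_linear[OF bounded_linear_mult_right])
      ultimately have "L_op \<sigma> b (\<lambda>x. 1 * \<phi> x + \<zeta> * w x) x \<le> 0"
        using sub unfolding viscosity_subsolution_def by blast
      moreover have "0 \<le> \<zeta> * L_op \<sigma> b w x" using Lw x \<zeta> by simp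
      ultimately show "L_op \<sigma> b \<phi> x \<le> 0" unfolding L_op_linear[OF \<phi> w] by linarith
    qed
    have 3: "\<forall>\<^sub>F x in at_infinity. ?V x < c" for c
    proof -
      \<comment> \<open>Eventually V < (\<zeta>/2) w, so V - \<zeta> w < - (\<zeta>/2) w, which
        drops below c once w > -2c/\<zeta>.\<close>
      have "ereal (\<zeta> / 2) > 0" using \<zeta> by simp
      then have "\<forall>\<^sub>F x in at_infinity. ereal (V x / w x) < ereal (\<zeta> / 2)"
        using lim unfolding Limsup_le_iff by blast
      moreover have "\<forall>\<^sub>F x in at_infinity. max 0 (- 2 * c / \<zeta>) < w x"
        using winf unfolding filterlim_at_top_dense by blast
      ultimately show ?thesis
      proof eventually_elim
        case (elim x)
        then have "V x < \<zeta> / 2 * w x" by (simp add: pos_divide_less_eq)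
        moreover have "- 2 * c < w x * \<zeta>"
          using elim pos_divide_less_eq[OF \<zeta>, of "- 2 * c" "w x"] by auto
        ultimately show ?case by (simp add: algebra_simps)
      qed
    qed
    obtain y where "norm y = R" "?V x \<le> ?V y"
      by (rule exterior_maximum_on_sphere[OF \<sigma> b H 1 2 R 3 x]) (rule that)
    then show ?thesis by auto
  qed
  have ne: "sphere (0::real^'n) R \<noteq> {}" using vector_choose_size[of R] R by (auto simp: sphere_def)
  obtain s where s: "s \<in> sphere 0 R" "\<And>y. y \<in> sphere 0 R \<Longrightarrow> V y \<le> V s"
    using usc_attains_max[OF V compact_sphere ne] by blast
  \<comment> \<open>The point y from \<open>ext\<close> depends on \<zeta>; the bounds V y \<le> V s
    and w s' \<le> w y do not.\<close>
  obtain s' where s': "\<And>y. y \<in> sphere 0 R \<Longrightarrow> w s' \<le> w y"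
    using continuous_attains_inf[OF compact_sphere ne continuous_on_subset[OF wc]] by blast
  have out: "V x \<le> V s" if x: "R \<le> norm x" for x
  proof (rule ccontr)
    assume "\<not> V x \<le> V s"
    define d where "d = w x - w s'"
    \<comment> \<open>A single small \<zeta> replaces the limit: it makes \<zeta> d smaller than the
      supposed excess V x - V s, and the added 1 avoids division by zero.\<close>
    define \<zeta> where "\<zeta> = (V x - V s) / (\<bar>d\<bar> + 1)"
    have \<zeta>: "0 < \<zeta>" using \<open>\<not> V x \<le> V s\<close> by (simp add: \<zeta>_def)
    obtain y where y: "norm y = R" "V x - \<zeta> * w x \<le> V y - \<zeta> * w y" using ext[OF \<zeta> x] by blast
    have "V y \<le> V s" "\<zeta> * w s' \<le> \<zeta> * w y" using s(2) s' y(1) \<zeta> by simp_all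
    then have "V x - V s \<le> \<zeta> * d" using y(2) by (simp add: d_def algebra_simps)
    also have "\<dots> < \<zeta> * (\<bar>d\<bar> + 1)" using \<zeta> by (intro mult_strict_left_mono) auto
    also have "\<dots> = V x - V s" by (simp add: \<zeta>_def)
    finally show False by simp
  qed
  obtain t where t: "t \<in> cball 0 R" "\<And>y. y \<in> cball 0 R \<Longrightarrow> V y \<le> V t"
    using usc_attains_max[OF V compact_cball, of 0 R] R by (metis cball_eq_empty not_less_iff_gr_or_eq)
  have max: "V x \<le> V t" for x
  proof (cases "R \<le> norm x")
    case True
    then show ?thesis using out[of x] t(2)[of s] s(1) by simp
  qed (use t(2) in simp)
  have "viscosity_subsolution_on UNIV \<sigma> b V"
    using sub by (simp add: viscosity_subsolution_def viscosity_subsolution_on_def)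
  from strong_maximum_principle[OF \<sigma> b H open_UNIV V this max]
  have op: "open {x. V x = V t}" by simp
  have cl: "closed {x. V x = V t}"
  proof -
    have "- {x. V x = V t} = {x. V x < V t}" using max by (auto simp: less_le)
    then show ?thesis unfolding closed_def using usc_open[OF V] by simp
  qed
  \<comment> \<open>The maximum set contains t, and the whole space is connected.\<close>
  from clopen[THEN iffD1, OF conjI[OF cl op]] have "V x = V t" for x by blast
  then show ?thesis unfolding constant_on_def by blast
qed

theorem proposition3p1:
  fixes \<sigma> :: "real^'n \<Rightarrow> real^'m^'n" and b :: "real^'n \<Rightarrow> real^'n"
    and w :: "real^'n \<Rightarrow> real" and R\<^sub>0 :: real
  assumes "smooth \<sigma>" and "smooth b"
    and "hoermander_condition (\<lambda>j x. column j (\<sigma> x))"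
    and "smooth w" and "R\<^sub>0 > 0"
    and "\<forall>x \<in> - closure (ball 0 R\<^sub>0). L_op \<sigma> b w x \<ge> 0"
    and "filterlim w at_top at_infinity"
  shows "(\<forall>V. usc V \<and> viscosity_subsolution \<sigma> b V \<and>
            Limsup at_infinity (\<lambda>x. ereal (V x / w x)) \<le> 0 \<longrightarrow> V constant_on UNIV)
       \<and> (\<forall>V. lsc V \<and> viscosity_supersolution \<sigma> b V \<and>
            Liminf at_infinity (\<lambda>x. ereal (V x / w x)) \<ge> 0 \<longrightarrow> V constant_on UNIV)"
proof (intro conjI allI impI; elim conjE)
  have Lw: "0 \<le> L_op \<sigma> b w x" if "R\<^sub>0 < norm x" for x
    using assms(5,6) that by (simp add: closure_ball)
  note liouville = liouville_subsolution[OF assms(1-3) smooth_C_k[OF assms(4)] assms(5) Lw assms(7)]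
  show "V constant_on UNIV" if "usc V" "viscosity_subsolution \<sigma> b V"
      "Limsup at_infinity (\<lambda>x. ereal (V x / w x)) \<le> 0" for V
    by (rule liouville[OF _ that])
  show "V constant_on UNIV" if V: "lsc V" and super: "viscosity_supersolution \<sigma> b V"
      and lim: "Liminf at_infinity (\<lambda>x. ereal (V x / w x)) \<ge> 0" for V
  proof -
    \<comment> \<open>Part (ii) is part (i) for -V: a test function \<phi> for -V from above becomes
      the test function -\<phi> for V from below, and the lower limit changes sign into an upper
      limit.\<close>
    have "usc (\<lambda>x. - V x)"
      unfolding usc_def
    proof (intro allI impI)
      fix x a assume "- V x < a"
      then have "\<forall>\<^sub>F y in nhds x. - a < V y" using V unfolding lsc_def by simp
      then show "\<forall>\<^sub>F y in nhds x. - V y < a" by eventually_elim simp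
    qed
    moreover have "viscosity_subsolution \<sigma> b (\<lambda>x. - V x)"
      unfolding viscosity_subsolution_def
    proof (intro allI impI)
      fix \<phi> x assume \<phi>: "C_k 2 \<phi>" and loc: "\<forall>\<^sub>F y in nhds x. - V y - \<phi> y \<le> - V x - \<phi> x"
      from loc have "\<forall>\<^sub>F y in nhds x. V x - - \<phi> x \<le> V y - - \<phi> y" by eventually_elim simp
      then have "0 \<le> L_op \<sigma> b (\<lambda>x. - \<phi> x) x"
        using super C_k_uminus[OF \<phi>] unfolding viscosity_supersolution_def by blast
      then show "L_op \<sigma> b \<phi> x \<le> 0" by (simp add: L_op_uminus[OF \<phi>])
    qed
    moreover have "Limsup at_infinity (\<lambda>x. ereal (- V x / w x)) \<le> 0"
      using lim ereal_Limsup_uminus[of at_infinity "\<lambda>x. ereal (V x / w x)"]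
      by (simp add: ereal_uminus_le_reorder)
    ultimately have "(\<lambda>x. - V x) constant_on UNIV" by (rule liouville[rotated])
    then show ?thesis unfolding constant_on_def by (metis minus_equation_iff)
  qed
qed

end
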